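(* For each $n$ let $q=q(n)$, $r=r(n)>0$, $\sigma^2=\sigma^2(n)>0$, and let $\{X_t\}^{(n)}$ be a continuous-time random walk on $\mathbb{Z}_q^n$ as in the context, with increment vector $Y^{(n)}$ satisfying $\|Y^{(n)}\|_1\le r$, $\|Y^{(n)}\|_\infty<q/2$, each coordinate of variance $\sigma^2/n$, and correlation matrix $\Gamma_n$. Let $\varepsilon\in(0,1)$. (a) Suppose $(Y^{(n)})$ satisfies the Decay Condition and $(\Gamma_n)$ satisfies the Correlation Condition with bounding function $g$. Let $S:=\sup_n\|\Psi_n\|_{\max}$ and $$\alpha:=\inf\{z\ge1:\ 4\varepsilon^2\ge\exp((2+S)g(z))-1\}.$$ If $n\to\infty$, $q\to\infty$ and $r^2/q\to0$, then for $t=t_n=\dfrac{nq^2\log(\alpha n)}{4\pi^2\sigma^2}\Big(1-\dfrac{r^2}{12q}\Big)^{-1}$ we have $d^{(n)}(t_n)\le\varepsilon+o(1)$. (b) If $q\to\infty$, $\log(n)\cdot\sup_{k\neq\ell}|(\Gamma_n)_{k\ell}|\to0$ and $\log(n)\, r^2/q^2\to0$ as $n\to\infty$, then for all sufficiently large $n$, $$t^{(n)}_{\mathrm{mix}}(\varepsilon)\ \ge\ \frac{nq^2}{4\pi^2\sigma^2}\Big(\log n+\log\Big(\frac{\varepsilon^{-1}-1}{5}\Big)\Big).$$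
   Context: Elements of $\mathbb{Z}_q^n$ ($\mathbb{Z}_q=\mathbb{Z}/q\mathbb{Z}$) are represented by $(\mathbb{Z}\cap[-q/2,q/2))^n$. Setup: $\mu$ is a probability measure on $\mathbb{Z}_q^n$ with $\mu(y)=\mu(-y)$ whose support generates $\mathbb{Z}_q^n$; $P(x,y)=\mu(y-x)$ is the (irreducible, symmetric) transition matrix of the discrete-time walk; $Y\in\mathbb{Z}^n$ is a random vector with law $\mu$ viewed in the representatives $(\mathbb{Z}\cap[-q/2,q/2))^n$. Each coordinate of $Y$ has variance $\sigma^2/n$, and $\mathrm{Var}(Y)=\frac{\sigma^2}{n}\Gamma$, with $\Gamma=\Gamma_n$ the correlation matrix; when $\Gamma_n$ is invertible write $\Psi_n=\Gamma_n^{-1}$. $\Phi_Y(\theta)=\mathbb{E}[e^{i\theta\cdot Y}]$ is the characteristic function of $Y$ (real-valued by symmetry). $\{X_t\}$ is the rate-1 continuous-time chain with rate matrix $P-I$, kernel $H_t=e^{t(P-I)}$; $d(t)=\max_x\|H_t(x,\cdot)-\mathrm{Unif}(\mathbb{Z}_q^n)\|_{TV}$ and $t_{\mathrm{mix}}(\varepsilon)=\inf\{t:d(t)\le\varepsilon\}$. For a matrix $M$, $\|M\|_{\max}=\max_{a,b}|M_{ab}|$. Decay Condition: with $\mathcal{L}=\{y\in(\mathbb{Z}\cap[-q/2,q/2))^n:\|2\pi y/q\|_\infty>1/\sqrt q\}$, for every sequence $t=t_n\ge \frac{nq^2\log n}{4\pi^2\sigma^2}$, $\sum_{y\in\mathcal{L}}\exp\big(2t(\Phi_Y(2\pi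 y/q)-1)\big)\to0$ as $n\to\infty$. Correlation Condition for a sequence $(\Gamma_n)$ of invertible $n\times n$ correlation matrices: (i) $\sup_n\|\Psi_n\|_{\max}<\infty$; (ii) letting $\Psi_{n,k}$ be the principal submatrix of the first $k$ rows and columns of $\Psi_n$, partitioned as $\begin{bmatrix}\Psi^{(11)}_{n,k}&\Psi^{(12)}_{n,k}\\\Psi^{(21)}_{n,k}&\Psi^{(22)}_{n,k}\end{bmatrix}$ with $\Psi^{(11)}_{n,k}$ the leading $(k-1)\times(k-1)$ block and $\Psi^{(22)}_{n,k}$ the $(k,k)$ entry, define $a^{(n)}_1=(\Psi_n)_{11}^{-1}$ and $a^{(n)}_k=\big(\Psi^{(22)}_{n,k}-\Psi^{(21)}_{n,k}(\Psi^{(11)}_{n,k})^{-1}\Psi^{(12)}_{n,k}\big)^{-1}$ for $k\ge2$; then there is a monotone decreasing function $g:[1,\infty)\to[0,\infty)$ independent of $n$ with $g(\alpha)\to0$ as $\alpha\to\infty$ such that $\sup_n\sum_{k=1}^n(\alpha n)^{-a_k^{(n)}}\le g(\alpha)$ for all $\alpha\ge1$. *)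

theory Defs
  imports "HOL-Analysis.Analysis"
begin

text \<open>Vectors of Z^n are functions nat => int, zero outside the coordinates 0..n-1.\<close>

definition redq :: "nat \<Rightarrow> int \<Rightarrow> int" where
  "redq q x = ((x + int q div 2) mod int q) - int q div 2"

definition reps :: "nat \<Rightarrow> nat \<Rightarrow> (nat \<Rightarrow> int) set" where
  "reps q n = {y. (\<forall>i<n. - int q \<le> 2 * y i \<and> 2 * y i < int q) \<and> (\<forall>i\<ge>n. y i = 0)}"

definition addq :: "nat \<Rightarrow> nat \<Rightarrow> (nat \<Rightarrow> int) \<Rightarrow> (nat \<Rightarrow> int) \<Rightarrow> (nat \<Rightarrow> int)" where
  "addq q n x y = (\<lambda>i. if i < n then redq q (x i + y i) else 0)"

definition negq :: "nat \<Rightarrow> nat \<Rightarrow> (nat \<Rightarrow> int) \<Rightarrow> (nat \<Rightarrow> int)" where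
  "negq q n y = (\<lambda>i. if i < n then redq q (- y i) else 0)"

definition subq :: "nat \<Rightarrow> nat \<Rightarrow> (nat \<Rightarrow> int) \<Rightarrow> (nat \<Rightarrow> int) \<Rightarrow> (nat \<Rightarrow> int)" where
  "subq q n x y = (\<lambda>i. if i < n then redq q (x i - y i) else 0)"

text \<open>Submonoid generated by S (= generated subgroup, as the group is finite).\<close>
inductive_set gen_by :: "nat \<Rightarrow> nat \<Rightarrow> (nat \<Rightarrow> int) set \<Rightarrow> (nat \<Rightarrow> int) set"
  for q n S where
  gen_zero: "(\<lambda>i. 0) \<in> gen_by q n S"
| gen_step: "x \<in> gen_by q n S \<Longrightarrow> s \<in> S \<Longrightarrow> addq q n x s \<in> gen_by q n S"

definition sym_walk_measure :: "nat \<Rightarrow> nat \<Rightarrow> ((nat \<Rightarrow> int) \<Rightarrow> real) \<Rightarrow> bool" where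
  "sym_walk_measure q n mu \<longleftrightarrow>
     (\<forall>y. 0 \<le> mu y) \<and> (\<forall>y. y \<notin> reps q n \<longrightarrow> mu y = 0) \<and>
     (\<Sum>y\<in>reps q n. mu y) = 1 \<and>
     (\<forall>y\<in>reps q n. mu y = mu (negq q n y)) \<and>
     gen_by q n {y\<in>reps q n. mu y > 0} = reps q n"

definition Pmat :: "nat \<Rightarrow> nat \<Rightarrow> ((nat \<Rightarrow> int) \<Rightarrow> real) \<Rightarrow> (nat \<Rightarrow> int) \<Rightarrow> (nat \<Rightarrow> int) \<Rightarrow> real" where
  "Pmat q n mu x y = mu (subq q n y x)"

fun fmpow :: "'a set \<Rightarrow> ('a \<Rightarrow> 'a \<Rightarrow> real) \<Rightarrow> nat \<Rightarrow> 'a \<Rightarrow> 'a \<Rightarrow> real" where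
  "fmpow A M 0 = (\<lambda>x y. if x = y then 1 else 0)"
| "fmpow A M (Suc k) = (\<lambda>x y. \<Sum>z\<in>A. M x z * fmpow A M k z y)"

definition Hker :: "nat \<Rightarrow> nat \<Rightarrow> ((nat \<Rightarrow> int) \<Rightarrow> real) \<Rightarrow> real \<Rightarrow> (nat \<Rightarrow> int) \<Rightarrow> (nat \<Rightarrow> int) \<Rightarrow> real" where
  "Hker q n mu t x y =
     (\<Sum>k. t ^ k / fact k *
        fmpow (reps q n) (\<lambda>a b. Pmat q n mu a b - (if a = b then 1 else 0)) k x y)"

definition tv_unif :: "'a set \<Rightarrow> ('a \<Rightarrow> real) \<Rightarrow> real" where
  "tv_unif A \<nu> = Max ((\<lambda>B. \<bar>(\<Sum>y\<in>B. \<nu> y) - real (card B) / real (card A)\<bar>) ` Pow A)"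

definition dwalk :: "nat \<Rightarrow> nat \<Rightarrow> ((nat \<Rightarrow> int) \<Rightarrow> real) \<Rightarrow> real \<Rightarrow> real" where
  "dwalk q n mu t = Max ((\<lambda>x. tv_unif (reps q n) (Hker q n mu t x)) ` reps q n)"

definition tmix :: "nat \<Rightarrow> nat \<Rightarrow> ((nat \<Rightarrow> int) \<Rightarrow> real) \<Rightarrow> real \<Rightarrow> real" where
  "tmix q n mu \<epsilon> = Inf {t. 0 \<le> t \<and> dwalk q n mu t \<le> \<epsilon>}"

definition Ex_mu :: "nat \<Rightarrow> nat \<Rightarrow> ((nat \<Rightarrow> int) \<Rightarrow> real) \<Rightarrow> ((nat \<Rightarrow> int) \<Rightarrow> real) \<Rightarrow> real" where
  "Ex_mu q n mu f = (\<Sum>y\<in>reps q n. mu y * f y)"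

definition Cov_mu :: "nat \<Rightarrow> nat \<Rightarrow> ((nat \<Rightarrow> int) \<Rightarrow> real) \<Rightarrow> nat \<Rightarrow> nat \<Rightarrow> real" where
  "Cov_mu q n mu k l =
     Ex_mu q n mu (\<lambda>y. (real_of_int (y k) - Ex_mu q n mu (\<lambda>z. real_of_int (z k))) *
                       (real_of_int (y l) - Ex_mu q n mu (\<lambda>z. real_of_int (z l))))"

definition Var_mu :: "nat \<Rightarrow> nat \<Rightarrow> ((nat \<Rightarrow> int) \<Rightarrow> real) \<Rightarrow> nat \<Rightarrow> real" where
  "Var_mu q n mu k = Cov_mu q n mu k k"

definition Corr_mu :: "nat \<Rightarrow> nat \<Rightarrow> ((nat \<Rightarrow> int) \<Rightarrow> real) \<Rightarrow> nat \<Rightarrow> nat \<Rightarrow> real" where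
  "Corr_mu q n mu k l =
     (if k < n \<and> l < n then Cov_mu q n mu k l / sqrt (Var_mu q n mu k * Var_mu q n mu l) else 0)"

text \<open>Characteristic function of Y (real-valued by symmetry; we take the real part).\<close>
definition Phi_mu :: "nat \<Rightarrow> nat \<Rightarrow> ((nat \<Rightarrow> int) \<Rightarrow> real) \<Rightarrow> (nat \<Rightarrow> real) \<Rightarrow> real" where
  "Phi_mu q n mu \<theta> =
     Re (\<Sum>y\<in>reps q n. complex_of_real (mu y) * cis (\<Sum>i<n. \<theta> i * real_of_int (y i)))"

definition mmul :: "nat \<Rightarrow> (nat \<Rightarrow> nat \<Rightarrow> real) \<Rightarrow> (nat \<Rightarrow> nat \<Rightarrow> real) \<Rightarrow> nat \<Rightarrow> nat \<Rightarrow> real" where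
  "mmul n A B i j = (\<Sum>l<n. A i l * B l j)"

definition is_inverse :: "nat \<Rightarrow> (nat \<Rightarrow> nat \<Rightarrow> real) \<Rightarrow> (nat \<Rightarrow> nat \<Rightarrow> real) \<Rightarrow> bool" where
  "is_inverse n A B \<longleftrightarrow> (\<forall>i<n. \<forall>j<n. mmul n A B i j = (if i = j then 1 else 0) \<and>
                                          mmul n B A i j = (if i = j then 1 else 0))"

definition invertible_n :: "nat \<Rightarrow> (nat \<Rightarrow> nat \<Rightarrow> real) \<Rightarrow> bool" where
  "invertible_n n A \<longleftrightarrow> (\<exists>B. is_inverse n A B)"

definition minv :: "nat \<Rightarrow> (nat \<Rightarrow> nat \<Rightarrow> real) \<Rightarrow> nat \<Rightarrow> nat \<Rightarrow> real" where
  "minv n A = (SOME B. is_inverse n A B \<and> (\<forall>i j. n \<le> i \<or> n \<le> j \<longrightarrow> B i j = 0))"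

definition max_norm :: "nat \<Rightarrow> (nat \<Rightarrow> nat \<Rightarrow> real) \<Rightarrow> real" where
  "max_norm n A = Max ({\<bar>A i j\<bar> | i j. i < n \<and> j < n} \<union> {0})"

text \<open>The numbers a_k (k = 1..n, 1-based as in the paper) built from the inverse Psi of Gamma:
  a_1 = (Psi_11)^(-1), a_k = (Psi22 - Psi21 (Psi11)^(-1) Psi12)^(-1) for the k x k leading
  principal submatrix of Psi.\<close>
definition schur_a :: "(nat \<Rightarrow> nat \<Rightarrow> real) \<Rightarrow> nat \<Rightarrow> real" where
  "schur_a Psi k =
     (if k = 1 then 1 / Psi 0 0
      else 1 / (Psi (k-1) (k-1) -
        (let Inv11 = minv (k-1) (\<lambda>i j. if i < k-1 \<and> j < k-1 then Psi i j else 0) in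
         \<Sum>i<k-1. \<Sum>j<k-1. Psi (k-1) i * Inv11 i j * Psi j (k-1))))"

definition correlation_condition :: "(nat \<Rightarrow> nat \<Rightarrow> nat \<Rightarrow> real) \<Rightarrow> (real \<Rightarrow> real) \<Rightarrow> bool" where
  "correlation_condition Psi g \<longleftrightarrow>
     bdd_above ((\<lambda>n. max_norm n (Psi n)) ` {1..}) \<and>
     (\<forall>a\<ge>1. \<forall>b\<ge>a. g b \<le> g a) \<and> (\<forall>a\<ge>1. 0 \<le> g a) \<and> (g \<longlongrightarrow> 0) at_top \<and>
     (\<forall>a\<ge>1. \<forall>n\<ge>1. (\<Sum>k=1..n. (a * real n) powr (- schur_a (Psi n) k)) \<le> g a)"

definition Lset :: "nat \<Rightarrow> nat \<Rightarrow> (nat \<Rightarrow> int) set" where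
  "Lset q n = {y\<in>reps q n. \<exists>i<n. \<bar>2 * pi * real_of_int (y i) / real q\<bar> > 1 / sqrt (real q)}"

definition decay_condition :: "(nat \<Rightarrow> nat) \<Rightarrow> (nat \<Rightarrow> real) \<Rightarrow> (nat \<Rightarrow> (nat \<Rightarrow> int) \<Rightarrow> real) \<Rightarrow> bool" where
  "decay_condition q sig2 mu \<longleftrightarrow>
     (\<forall>t :: nat \<Rightarrow> real.
        (\<forall>n. t n \<ge> real n * real (q n)^2 * ln (real n) / (4 * pi^2 * sig2 n)) \<longrightarrow>
        ((\<lambda>n. \<Sum>y\<in>Lset (q n) n.
            exp (2 * t n * (Phi_mu (q n) n (mu n) (\<lambda>i. 2 * pi * real_of_int (y i) / real (q n)) - 1)))
          \<longlongrightarrow> 0) sequentially)"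

end

theory Submission
  imports Defs
begin

text \<open>
  Upper bound. Diagonalising the walk by characters gives
  \<open>4 d(t)\<^sup>2 \<le> \<Sum>y\<noteq>0. exp (2 t (\<Phi>(2 \<pi> y / q) - 1))\<close>. The Decay Condition disposes of large \<open>y\<close>; for
  the others \<open>cos u \<le> 1 - u\<^sup>2/2 + u\<^sup>4/24\<close> reduces the sum to \<open>\<Sum>y\<noteq>0. (\<alpha> n) powr (- y\<^sup>T \<Gamma> y)\<close>. Block
  inversion of the leading minors of \<open>\<Psi> = \<Gamma>\<^sup>-\<^sup>1\<close> writes \<open>y\<^sup>T \<Gamma> y\<close> as
  \<open>\<Sum>k. a\<^sub>k (y\<^sub>k - linear form in y\<^sub>1, \<dots>, y\<^sub>k\<^sub>-\<^sub>1)\<^sup>2\<close>, so one may sum over \<open>y\<^sub>n, y\<^sub>n\<^sub>-\<^sub>1, \<dots>\<close> in turn: a shifted Gaussian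
  sum over the integers is largest at shift 0, where it is at most \<open>1 + (2 + S) (\<alpha> n) powr (- a\<^sub>k)\<close>.

  Lower bound. Second moment method for \<open>f x = \<Sum>k. cos (2 \<pi> x\<^sub>k / q)\<close>: weak correlation makes the terms
  asymptotically uncorrelated under the walk started at 0.
\<close>

subsection \<open>Shifted Gaussian sums over the integers\<close>

text \<open>Correlation keeps the lattice sum from factoring over coordinates. After completing
  squares, the sum over the last coordinate is a Gaussian sum whose shift depends on all earlier
  coordinates, so only a bound uniform in the shift decouples them; this is why \<open>theta\<close>
  is studied as a function of its shift. The bound must moreover be 1 plus a fixed multiple of
  \<open>x powr (- a)\<close>, with \<open>x = \<alpha> n\<close> and \<open>a\<close> a Schur
  number, because the Correlation Condition controls the sum of exactly these powers. When
  \<open>a\<close> is small, the factor \<open>1 / (1 - exp (- 3 * l))\<close> from the geometric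
  tail is large; it is tamed by \<open>1 / a \<le> P k k \<le> S\<close>, and this is the source of
  \<open>2 + S\<close>. A product of terms \<open>1 + f k\<close> is at most the exponential of the
  sum, and removing the term \<open>y = 0\<close> leaves the expression
  \<open>exp ((2 + S) * g z) - 1\<close> that defines \<alpha>.\<close>

lemma has_sum_even_int:
  fixes f :: "int \<Rightarrow> real"
  assumes even: "\<And>m. f (- m) = f m"
    and S: "((\<lambda>n. f (int (Suc n))) has_sum S) UNIV"
  shows "(f has_sum (f 0 + 2 * S)) UNIV"
proof -
  have b1: "bij_betw (\<lambda>n. int (Suc n)) UNIV {0<..}"
    by (rule bij_betwI[where g = "\<lambda>m. nat (m - 1)"]) auto
  have b2: "bij_betw uminus {..<0} {0::int<..}"
    by (rule bij_betwI[where g = uminus]) auto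
  have pos: "(f has_sum S) {0<..}"
    using S unfolding has_sum_reindex_bij_betw[OF b1] .
  have neg: "(f has_sum S) {..<0}"
    using pos unfolding has_sum_reindex_bij_betw[OF b2, symmetric] even .
  have zero: "(f has_sum f 0) {0}"
    using has_sum_finite[of "{0}" f] by simp
  have "(f has_sum (S + S)) ({0<..} \<union> {..<0})"
    by (rule has_sum_Un_disjoint[OF pos neg]) auto
  hence "(f has_sum (f 0 + (S + S))) ({0} \<union> ({0<..} \<union> {..<0}))"
    by (rule has_sum_Un_disjoint[OF zero]) auto
  moreover have "{0} \<union> ({0<..} \<union> {..<0}) = (UNIV :: int set)" by auto
  ultimately show ?thesis by (simp only: mult_2)
qed

definition theta :: "real \<Rightarrow> real \<Rightarrow> real" where
  "theta l s = (\<Sum>\<^sub>\<infinity>m::int. exp (- l * (real_of_int m + s)\<^sup>2))"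

lemma geometric_summable_int:
  assumes "l > 0"
  shows "(\<lambda>m::int. exp (- l * \<bar>real_of_int m\<bar>)) summable_on UNIV"
proof -
  have "summable (\<lambda>n. exp (- l) ^ n)" using assms by (intro summable_geometric) simp
  hence "summable (\<lambda>n. exp (- l) ^ Suc n)" by (subst summable_Suc_iff)
  hence "(\<lambda>n. exp (- l) ^ Suc n) summable_on UNIV"
    by (rule summable_nonneg_imp_summable_on) simp
  moreover have "exp (- l) ^ Suc n = exp (- l * \<bar>real_of_int (int (Suc n))\<bar>)" for n
    using exp_of_nat2_mult[of "- l" "Suc n"] by simp
  ultimately have "(\<lambda>n. exp (- l * \<bar>real_of_int (int (Suc n))\<bar>)) summable_on UNIV"
    by (simp only:)
  then obtain S where "((\<lambda>n. exp (- l * \<bar>real_of_int (int (Suc n))\<bar>)) has_sum S) UNIV"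
    by (auto simp: summable_on_def)
  from has_sum_even_int[where f="\<lambda>m. exp (- l * \<bar>real_of_int m\<bar>)", OF _ this]
  show ?thesis by (auto simp: summable_on_def)
qed

text \<open>Completing the square, via \<open>(x - 1/2) ^ 2\<close> for \<open>x \<ge> 0\<close> and
  \<open>(x + 3/2) ^ 2\<close> for \<open>x \<le> -1\<close>, gives
  \<open>(x + s) ^ 2 \<ge> |x| - 5/4\<close>. The constant does not depend on \<open>s\<close>, so
  one geometric series dominates all shifts in the unit interval.\<close>

lemma gauss_le_geometric:
  assumes "l > 0" "0 \<le> s" "s \<le> 1"
  shows "exp (- l * (real_of_int m + s)\<^sup>2) \<le> exp (5 / 4 * l) * exp (- l * \<bar>real_of_int m\<bar>)"
proof -
  define x where "x = real_of_int m"
  have "\<bar>x\<bar> - 5/4 \<le> (x + s)\<^sup>2"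
  proof (cases "x \<ge> 0")
    case True
    have "x\<^sup>2 \<le> (x + s)\<^sup>2" using True assms by (intro power_mono) auto
    moreover have "0 \<le> (x - 1/2)\<^sup>2" by simp
    ultimately show ?thesis using True by (simp add: power2_eq_square algebra_simps)
  next
    case False
    hence "m \<le> -1" by (simp add: x_def)
    hence x1: "x \<le> -1" by (simp add: x_def)
    have "(- x - 1)\<^sup>2 \<le> (- x - s)\<^sup>2" using x1 assms by (intro power_mono) auto
    moreover have "0 \<le> (x + 3/2)\<^sup>2" by simp
    ultimately show ?thesis using False by (simp add: power2_eq_square algebra_simps)
  qed
  hence "l * (\<bar>x\<bar> - 5/4) \<le> l * (x + s)\<^sup>2" using assms by simp
  thus ?thesis unfolding x_def[symmetric] exp_add[symmetric] by (simp add: algebra_simps)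
qed

lemma bij_betw_add_int: "bij_betw (\<lambda>m::int. m + k) UNIV UNIV"
  by (rule bij_betwI[where g="\<lambda>m. m - k"]) auto

lemma gauss_summable:
  assumes "l > 0"
  shows "(\<lambda>m::int. exp (- l * (real_of_int m + s)\<^sup>2)) summable_on UNIV"
proof -
  have "(\<lambda>m::int. exp (- l * (real_of_int m + frac s)\<^sup>2)) summable_on UNIV"
  proof (rule summable_on_comparison_test)
    show "(\<lambda>m::int. exp (5 / 4 * l) * exp (- l * \<bar>real_of_int m\<bar>)) summable_on UNIV"
      by (intro summable_on_cmult_right geometric_summable_int assms)
    fix m :: int
    show "exp (- l * (real_of_int m + frac s)\<^sup>2) \<le> exp (5 / 4 * l) * exp (- l * \<bar>real_of_int m\<bar>)"
      by (intro gauss_le_geometric assms) (auto simp: frac_lt_1 less_imp_le)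
  qed simp
  hence "(\<lambda>m::int. exp (- l * (real_of_int (m + \<lfloor>s\<rfloor>) + frac s)\<^sup>2)) summable_on UNIV"
    using summable_on_reindex_bij_betw[OF bij_betw_add_int[of "\<lfloor>s\<rfloor>"],
        of "\<lambda>m. exp (- l * (real_of_int m + frac s)\<^sup>2)"] by simp
  thus ?thesis by (simp add: frac_def algebra_simps)
qed

lemma theta_frac: "theta l s = theta l (frac s)"
proof -
  have "theta l (frac s) = (\<Sum>\<^sub>\<infinity>m::int. exp (- l * (real_of_int (m + \<lfloor>s\<rfloor>) + frac s)\<^sup>2))"
    unfolding theta_def
    by (rule infsum_reindex_bij_betw[OF bij_betw_add_int[of "\<lfloor>s\<rfloor>"], symmetric])
  also have "\<dots> = theta l s" by (simp add: theta_def frac_def algebra_simps)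
  finally show ?thesis by simp
qed

text \<open>Periodicity (\<open>theta_frac\<close>) leaves only shifts in [0, 1). Uniformity in
  \<open>s\<close> is the point: it contradicts growth along the shifts \<open>2 ^ k * s\<close> in
  \<open>theta_le_theta_0\<close>.\<close>

lemma theta_bounded:
  assumes "l > 0"
  obtains C where "C > 0" "\<And>s. theta l s \<le> C"
proof
  let ?C = "\<Sum>\<^sub>\<infinity>m::int. exp (5 / 4 * l) * exp (- l * \<bar>real_of_int m\<bar>)"
  have *: "(\<lambda>m::int. exp (5 / 4 * l) * exp (- l * \<bar>real_of_int m\<bar>)) summable_on UNIV"
    by (intro summable_on_cmult_right geometric_summable_int assms)
  show "theta l s \<le> ?C + 1" for s
  proof -
    have "theta l (frac s) \<le> ?C" unfolding theta_def
      by (intro infsum_mono gauss_summable assms * gauss_le_geometric)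
        (auto simp: frac_ge_0 frac_lt_1 less_imp_le)
    thus ?thesis by (simp add: theta_frac[of l s])
  qed
  have "0 \<le> ?C" by (intro infsum_nonneg) simp
  thus "0 < ?C + 1" by simp
qed

lemma theta_nonneg: "theta l s \<ge> 0"
  unfolding theta_def by (intro infsum_nonneg) simp

lemma theta_ge_term:
  assumes "l > 0" shows "exp (- l * s\<^sup>2) \<le> theta l s"
proof -
  have "sum (\<lambda>m::int. exp (- l * (real_of_int m + s)\<^sup>2)) {0} \<le> theta l s"
    unfolding theta_def by (intro finite_sum_le_infsum gauss_summable assms) auto
  thus ?thesis by simp
qed

lemma theta_pos: "l > 0 \<Longrightarrow> theta l s > 0"
  using theta_ge_term[of l s] by (meson exp_gt_zero less_le_trans)

lemma has_sum_theta: "l > 0 \<Longrightarrow> ((\<lambda>m::int. exp (- l * (real_of_int m + s)\<^sup>2)) has_sum theta l s) UNIV"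
  unfolding theta_def by (intro has_sum_infsum gauss_summable)

lemma theta_product_has_sum:
  assumes "l > 0"
  shows "((\<lambda>(m::int, k::int). exp (- l * ((real_of_int m + s)\<^sup>2 + (real_of_int k + s')\<^sup>2)))
           has_sum (theta l s * theta l s')) UNIV"
proof -
  have 1: "((\<lambda>k::int. exp (- l * ((real_of_int m + s)\<^sup>2 + (real_of_int k + s')\<^sup>2))) has_sum
              exp (- l * (real_of_int m + s)\<^sup>2) * theta l s') UNIV" for m
    using has_sum_cmult_right[OF has_sum_theta[OF assms, of s'], of "exp (- l * (real_of_int m + s)\<^sup>2)"]
    unfolding exp_add[symmetric] distrib_left[symmetric] .
  have 2: "((\<lambda>m::int. exp (- l * (real_of_int m + s)\<^sup>2) * theta l s') has_sum theta l s * theta l s') UNIV"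
    by (intro has_sum_cmult_left has_sum_theta assms)
  have "((\<lambda>(m::int, k::int). exp (- l * ((real_of_int m + s)\<^sup>2 + (real_of_int k + s')\<^sup>2)))
           has_sum (theta l s * theta l s')) (UNIV \<times> UNIV)"
  proof (rule has_sum_SigmaI)
    show "(\<lambda>(m::int, k::int). exp (- l * ((real_of_int m + s)\<^sup>2 + (real_of_int k + s')\<^sup>2)))
            summable_on UNIV \<times> UNIV"
    proof (rule summable_on_SigmaI)
      show "((\<lambda>k. case (m, k) of (m, k) \<Rightarrow> exp (- l * ((real_of_int m + s)\<^sup>2 + (real_of_int k + s')\<^sup>2)))
              has_sum exp (- l * (real_of_int m + s)\<^sup>2) * theta l s') UNIV" for m
        unfolding prod.case by (rule 1)
      show "(\<lambda>m::int. exp (- l * (real_of_int m + s)\<^sup>2) * theta l s') summable_on UNIV"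
        by (rule has_sum_imp_summable[OF 2])
    qed simp
  next
    show "((\<lambda>k. case (m, k) of (m, k) \<Rightarrow> exp (- l * ((real_of_int m + s)\<^sup>2 + (real_of_int k + s')\<^sup>2)))
            has_sum exp (- l * (real_of_int m + s)\<^sup>2) * theta l s') UNIV" for m
      unfolding prod.case by (rule 1)
  qed (rule 2)
  thus ?thesis by (simp only: UNIV_Times_UNIV)
qed

section \<open>The product identity for theta sums and the maximum at shift 0\<close>

lemma rotate_squares:
  fixes a b s s' :: real
  shows "(a + b + s)\<^sup>2 + (a - b + s')\<^sup>2 = 2 * ((a + (s + s') / 2)\<^sup>2 + (b + (s - s') / 2)\<^sup>2)"
proof -
  define x y where "x = (s + s') / 2" and "y = (s - s') / 2"
  have "s = x + y" "s' = x - y" by (simp_all add: x_def y_def field_simps)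
  moreover have "(a + b + (x + y))\<^sup>2 + (a - b + (x - y))\<^sup>2 = 2 * ((a + x)\<^sup>2 + (b + y)\<^sup>2)"
    by algebra
  ultimately show ?thesis unfolding x_def[symmetric] y_def[symmetric] by simp
qed

text \<open>Rotating the lattice \<open>\<int>\<^sup>2\<close> by 45 degrees splits it into two cosets of a square lattice
  of twice the covolume.\<close>
lemma theta_product:
  assumes "l > 0"
  shows "theta l s * theta l s' =
           theta (2 * l) ((s + s') / 2) * theta (2 * l) ((s - s') / 2) +
           theta (2 * l) ((s + s' + 1) / 2) * theta (2 * l) ((s - s' + 1) / 2)"
proof -
  let ?f = "\<lambda>(m::int, k::int). exp (- l * ((real_of_int m + s)\<^sup>2 + (real_of_int k + s')\<^sup>2))"
  let ?E = "{(m::int, k::int). even (m + k)}" and ?O = "{(m::int, k::int). odd (m + k)}"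
  have l2: "2 * l > 0" using assms by simp
  let ?g0 = "\<lambda>(u::int, v::int). exp (- (2 * l) * ((real_of_int u + (s+s')/2)\<^sup>2 + (real_of_int v + (s-s')/2)\<^sup>2))"
  let ?g1 = "\<lambda>(u::int, v::int). exp (- (2 * l) * ((real_of_int u + (s+s'+1)/2)\<^sup>2 + (real_of_int v + (s-s'+1)/2)\<^sup>2))"
  have E: "(?f has_sum theta (2 * l) ((s + s') / 2) * theta (2 * l) ((s - s') / 2)) ?E"
  proof -
    have inj: "inj_on (\<lambda>(u::int, v). (u + v, u - v)) UNIV" by (rule inj_onI) auto
    have im: "(\<lambda>(u::int, v). (u + v, u - v)) ` UNIV = ?E"
    proof (intro set_eqI iffI)
      fix p :: "int \<times> int" assume p: "p \<in> ?E"
      obtain m k where mk: "p = (m, k)" by (cases p)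
      from p mk have "even (m + k)" by simp
      then obtain u where "m + k = 2 * u" by (rule evenE)
      hence "p = (\<lambda>(u, v). (u + v, u - v)) (u, m - u)" using mk by simp
      thus "p \<in> (\<lambda>(u::int, v). (u + v, u - v)) ` UNIV" by blast
    qed auto
    have eq: "?f \<circ> (\<lambda>(u, v). (u + v, u - v)) = ?g0"
    proof (rule ext)
      fix p :: "int \<times> int"
      obtain u v where p: "p = (u, v)" by (cases p)
      show "(?f \<circ> (\<lambda>(u, v). (u + v, u - v))) p = ?g0 p"
        unfolding p
        using rotate_squares[of u v s s']
        by (simp only: o_def prod.case of_int_add of_int_diff) (simp only: mult.assoc mult.left_commute mult_minus_left)
    qed
    show ?thesis using theta_product_has_sum[OF l2] unfolding im[symmetric] has_sum_reindex[OF inj] eq .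
  qed
  \<comment> \<open>Odd pairs are \<open>(u + v + 1, u - v)\<close>; moving the extra 1 into the
    first shift, \<open>s + 1\<close> in place of \<open>s\<close>, reduces them to the same
    rotation identity.\<close>
  have O: "(?f has_sum theta (2 * l) ((s + s' + 1) / 2) * theta (2 * l) ((s - s' + 1) / 2)) ?O"
  proof -
    have inj: "inj_on (\<lambda>(u::int, v). (u + v + 1, u - v)) UNIV" by (rule inj_onI) auto
    have im: "(\<lambda>(u::int, v). (u + v + 1, u - v)) ` UNIV = ?O"
    proof (intro set_eqI iffI)
      fix p :: "int \<times> int" assume p: "p \<in> ?O"
      obtain m k where mk: "p = (m, k)" by (cases p)
      from p mk have "odd (m + k)" by simp
      then obtain u where "m + k = 2 * u + 1" by (rule oddE)
      hence "p = (\<lambda>(u, v). (u + v + 1, u - v)) (u, m - u - 1)" using mk by simp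
      thus "p \<in> (\<lambda>(u::int, v). (u + v + 1, u - v)) ` UNIV" by blast
    qed auto
    have eq: "?f \<circ> (\<lambda>(u, v). (u + v + 1, u - v)) = ?g1"
    proof (rule ext)
      fix p :: "int \<times> int"
      obtain u v where p: "p = (u, v)" by (cases p)
      have *: "real_of_int u + real_of_int v + 1 + s = real_of_int u + real_of_int v + (s + 1)"
        "s + 1 + s' = s + s' + 1" "s + 1 - s' = s - s' + 1" by simp_all
      show "(?f \<circ> (\<lambda>(u, v). (u + v + 1, u - v))) p = ?g1 p"
        unfolding p
        using rotate_squares[of u v "s + 1" s']
        by (simp only: o_def prod.case of_int_add of_int_diff of_int_1 *) (simp only: mult.assoc mult.left_commute mult_minus_left)
    qed
    show ?thesis using theta_product_has_sum[OF l2] unfolding im[symmetric] has_sum_reindex[OF inj] eq .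
  qed
  have "(?f has_sum (theta (2 * l) ((s + s') / 2) * theta (2 * l) ((s - s') / 2) +
           theta (2 * l) ((s + s' + 1) / 2) * theta (2 * l) ((s - s' + 1) / 2))) (?E \<union> ?O)"
    by (rule has_sum_Un_disjoint[OF E O]) auto
  moreover have "?E \<union> ?O = UNIV" by auto
  ultimately show ?thesis
    using has_sum_unique[OF theta_product_has_sum[OF assms, of s s']] by simp
qed

text \<open>The product identity at the shift pairs \<open>(s, s)\<close>, \<open>(2 * s, 0)\<close>
  and \<open>(0, 0)\<close> involves only four values \<open>a, b, c, d\<close>. The claim is then
  the Cauchy-Schwarz inequality \<open>(a c + b d) ^ 2 \<le> (a ^ 2 + b ^ 2) (c ^ 2 + d ^ 2)\<close>
  in the plane.\<close>

lemma theta_power4_le: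
  assumes l: "l > 0"
  shows "theta l s ^ 4 \<le> theta l (2 * s) * theta l 0 ^ 3"
proof -
  define a b c d where "a = theta (2 * l) s" and "b = theta (2 * l) (s + 1/2)"
    and "c = theta (2 * l) 0" and "d = theta (2 * l) (1/2)"
  have 1: "theta l s * theta l s = a * c + b * d"
    using theta_product[OF l, of s s] by (simp add: a_def b_def c_def d_def field_simps)
  have 2: "theta l (2 * s) * theta l 0 = a * a + b * b"
    using theta_product[OF l, of "2 * s" 0] by (simp add: a_def b_def c_def d_def field_simps)
  have 3: "theta l 0 * theta l 0 = c * c + d * d"
    using theta_product[OF l, of 0 0] by (simp add: a_def b_def c_def d_def field_simps)
  have "theta l s ^ 4 = (theta l s * theta l s)\<^sup>2" by (simp add: power2_eq_square power4_eq_xxxx)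
  also have "\<dots> \<le> (a * a + b * b) * (c * c + d * d)"
    unfolding 1 using zero_le_power2[of "a * d - b * c"] by (simp add: power2_eq_square algebra_simps)
  also have "\<dots> = theta l (2 * s) * theta l 0 ^ 3"
    unfolding 2[symmetric] 3[symmetric] by (simp add: power3_eq_cube)
  finally show ?thesis .
qed

text \<open>The ratio \<open>f s = theta l s / theta l 0\<close> satisfies \<open>f s ^ 4 \<le> f (2 * s)\<close>, so \<open>f s > 1\<close>
  would make \<open>f\<close> unbounded along \<open>s, 2 * s, 4 * s, \<dots>\<close>; this replaces Poisson summation.\<close>
lemma theta_le_theta_0:
  assumes l: "l > 0"
  shows "theta l s \<le> theta l 0"
proof (rule ccontr)
  assume gt: "\<not> theta l s \<le> theta l 0"
  define f where "f s = theta l s / theta l 0" for s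
  have t0: "theta l 0 > 0" by (rule theta_pos[OF l])
  have f1: "f s > 1" using gt t0 by (simp add: f_def)
  have step: "f u ^ 4 \<le> f (2 * u)" for u
    using theta_power4_le[OF l, of u] t0
    by (simp add: f_def power_divide divide_simps power3_eq_cube power4_eq_xxxx mult_ac)
  have fn: "f u \<ge> 0" for u by (simp add: f_def theta_nonneg)
  have iter: "f s ^ (4 ^ k) \<le> f (2 ^ k * s)" for k
  proof (induction k)
    case (Suc k)
    have "f s ^ (4 ^ Suc k) = (f s ^ (4 ^ k)) ^ 4" by (simp add: power_mult[symmetric] mult.commute)
    also have "\<dots> \<le> f (2 ^ k * s) ^ 4" by (intro power_mono Suc) (simp add: fn)
    also have "\<dots> \<le> f (2 * (2 ^ k * s))" by (rule step)
    finally show ?case by (simp add: mult_ac)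
  qed simp
  obtain C where C: "C > 0" "\<And>s. theta l s \<le> C" using theta_bounded[OF l] by metis
  obtain k where k: "C / theta l 0 < f s ^ k" using real_arch_pow[OF f1] by blast
  have "k \<le> 4 ^ k" by (rule order.trans[OF less_imp_le[OF less_exp[of k]]]) (simp add: power_mono)
  hence "f s ^ k \<le> f s ^ (4 ^ k)" using f1 by (intro power_increasing) auto
  also have "\<dots> \<le> f (2 ^ k * s)" by (rule iter)
  also have "\<dots> \<le> C / theta l 0" using C(2) t0 by (simp add: f_def divide_right_mono)
  finally show False using k by simp
qed

text \<open>Since \<open>(n + 1) ^ 2 \<ge> 1 + 3 n\<close> for natural \<open>n\<close>, the
  positive half of the sum is dominated by a geometric series with ratio
  \<open>exp (- 3 * l)\<close> that has the exact leading term.\<close>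

lemma theta_0_le:
  assumes l: "l > 0"
  shows "theta l 0 \<le> 1 + 2 * exp (- l) / (1 - exp (- 3 * l))"
proof -
  have sm: "(\<lambda>n. exp (- 3 * l) ^ n) sums (1 / (1 - exp (- 3 * l)))"
    using l by (intro geometric_sums) simp
  have g: "((\<lambda>n. exp (- l) * exp (- 3 * l) ^ n) has_sum (exp (- l) * (1 / (1 - exp (- 3 * l))))) UNIV"
    by (intro has_sum_cmult_right sums_nonneg_imp_has_sum sm) simp
  have le: "exp (- l * (real_of_int (int (Suc n)) + 0)\<^sup>2) \<le> exp (- l) * exp (- 3 * l) ^ n" for n
  proof -
    have "n = 0 \<or> n \<ge> 1" by auto
    hence "real n * 1 \<le> real n * real n" by (cases "n = 0") auto
    hence "1 + 3 * real n \<le> (real_of_int (int (Suc n)))\<^sup>2"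
      by (simp add: power2_eq_square algebra_simps)
    hence "l * (1 + 3 * real n) \<le> l * (real_of_int (int (Suc n)))\<^sup>2" using l by simp
    moreover have "exp (- l) * exp (- 3 * l) ^ n = exp (- (l * (1 + 3 * real n)))"
      using exp_of_nat2_mult[of "- 3 * l" n, symmetric]
      by (simp only: exp_add[symmetric]) (simp add: distrib_left mult_ac)
    ultimately show ?thesis by simp
  qed
  have "(\<lambda>n. exp (- l * (real_of_int (int (Suc n)) + 0)\<^sup>2)) summable_on UNIV"
    by (rule summable_on_comparison_test[where f="\<lambda>n. exp (- l) * exp (- 3 * l) ^ n"])
       (use g le in \<open>auto simp: summable_on_def\<close>)
  then obtain S where S: "((\<lambda>n. exp (- l * (real_of_int (int (Suc n)) + 0)\<^sup>2)) has_sum S) UNIV"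
    by (auto simp: summable_on_def)
  have "S \<le> exp (- l) * (1 / (1 - exp (- 3 * l)))"
    by (rule has_sum_mono[OF S g]) (rule le)
  moreover have "theta l 0 = 1 + 2 * S"
    using has_sum_even_int[where f="\<lambda>m. exp (- l * (real_of_int m + 0)\<^sup>2)", OF _ S]
      has_sum_theta[OF l, of 0] by (simp add: has_sum_unique)
  ultimately show ?thesis by simp
qed

text \<open>With \<open>E = exp (3 * l)\<close> the claim reduces to
  \<open>2 \<le> S (E - 1)\<close>. As \<open>E - 1 \<ge> 3 l\<close>, it suffices that
  \<open>l S \<ge> 2/3\<close>, and \<open>l S = a S ln x \<ge> ln x\<close>; hence the threshold
  \<open>2/3\<close>.\<close>

lemma theta_0_le_linear:
  assumes a: "a > 0" "1 / a \<le> S" and x: "ln x \<ge> 2 / 3"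
  shows "theta (a * ln x) 0 \<le> 1 + (2 + S) * exp (- (a * ln x))"
proof -
  define l where "l = a * ln x"
  have l: "l > 0" using a x by (simp add: l_def)
  have lS: "1 \<le> 3 / 2 * l * S"
  proof -
    have "1 \<le> a * S" using a by (simp add: field_simps)
    also have "\<dots> \<le> a * S * (3 / 2 * ln x)"
    proof -
      have "a * S \<ge> 0" using a by (smt (verit) divide_pos_pos mult_nonneg_nonneg)
      thus ?thesis using x mult_left_mono[of 1 "3/2 * ln x" "a * S"] by simp
    qed
    finally show ?thesis by (simp add: l_def mult_ac)
  qed
  define E where "E = exp (3 * l)"
  have E: "E \<ge> 1 + 3 * l" unfolding E_def using exp_ge_add_one_self[of "3 * l"] by simp
  have em: "exp (- 3 * l) = 1 / E" by (simp add: E_def exp_minus inverse_eq_divide)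
  have S0: "S > 0" using a by (smt (verit) divide_pos_pos)
  have "2 * E \<le> (2 + S) * (E - 1)"
  proof -
    have "2 \<le> S * (3 * l)" using lS by (simp add: mult_ac)
    also have "\<dots> \<le> S * (E - 1)" using E S0 by (intro mult_left_mono) auto
    finally show ?thesis by (simp add: algebra_simps)
  qed
  hence "2 / (1 - exp (- 3 * l)) \<le> 2 + S"
    unfolding em using E l by (simp add: field_simps)
  from mult_left_mono[OF this, of "exp (- l)"]
  have "exp (- l) * (2 / (1 - exp (- 3 * l))) \<le> exp (- l) * (2 + S)" by simp
  thus ?thesis using theta_0_le[OF l] by (simp add: l_def[symmetric] mult_ac)
qed

subsection \<open>Successive Schur complements of an inverse matrix\<close>

definition qform :: "nat \<Rightarrow> (nat \<Rightarrow> nat \<Rightarrow> real) \<Rightarrow> (nat \<Rightarrow> real) \<Rightarrow> real" where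
  "qform n A y = (\<Sum>i<n. \<Sum>j<n. y i * A i j * y j)"

lemma qform_altdef: "qform n A y = (\<Sum>i<n. y i * (\<Sum>j<n. A i j * y j))"
  by (simp add: qform_def sum_distrib_left mult.assoc)

lemma is_inverseD:
  assumes "is_inverse n A B" "i < n" "j < n"
  shows "(\<Sum>l<n. A i l * B l j) = (if i = j then 1 else 0)"
        "(\<Sum>l<n. B i l * A l j) = (if i = j then 1 else 0)"
  using assms by (auto simp: is_inverse_def mmul_def)

lemma is_inverse_commute: "is_inverse n A B \<Longrightarrow> is_inverse n B A"
  by (auto simp: is_inverse_def)

lemma is_inverse_cong:
  assumes "\<And>i j. i < n \<Longrightarrow> j < n \<Longrightarrow> A i j = A' i j" "\<And>i j. i < n \<Longrightarrow> j < n \<Longrightarrow> B i j = B' i j"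
  shows "is_inverse n A B \<longleftrightarrow> is_inverse n A' B'"
proof -
  have "mmul n A B i j = mmul n A' B' i j" "mmul n B A i j = mmul n B' A' i j" if "i < n" "j < n" for i j
    unfolding mmul_def using assms that by (auto intro!: sum.cong)
  thus ?thesis by (simp add: is_inverse_def)
qed

lemma is_inverse_apply:
  assumes "is_inverse n A B" "i < n"
  shows "(\<Sum>j<n. A i j * (\<Sum>k<n. B j k * y k)) = y i"
proof -
  have "(\<Sum>j<n. A i j * (\<Sum>k<n. B j k * y k)) = (\<Sum>k<n. (\<Sum>j<n. A i j * B j k) * y k)"
    by (simp add: sum_distrib_left sum_distrib_right mult.assoc) (rule sum.swap)
  also have "\<dots> = (\<Sum>k<n. (if i = k then 1 else 0) * y k)"
    by (intro sum.cong refl) (use is_inverseD(1)[OF assms] in auto)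
  also have "\<dots> = (\<Sum>k<n. if i = k then y k else 0)"
    by (intro sum.cong) auto
  also have "\<dots> = y i" using assms(2) by simp
  finally show ?thesis .
qed

lemma is_inverse_unique:
  assumes "is_inverse n A B" "is_inverse n A C" "i < n" "j < n"
  shows "B i j = C i j"
proof -
  have "(\<Sum>k<n. B i k * (\<Sum>l<n. A k l * C l j)) = C i j"
    using is_inverse_apply[OF is_inverse_commute[OF assms(1)] assms(3), of "\<lambda>l. C l j"] .
  moreover have "(\<Sum>k<n. B i k * (\<Sum>l<n. A k l * C l j)) = (\<Sum>k<n. if k = j then B i k else 0)"
    by (intro sum.cong refl) (use is_inverseD(1)[OF assms(2) _ assms(4)] in auto)
  ultimately show ?thesis using assms(4) by simp
qed

lemma is_inverse_symmetric:
  assumes "is_inverse n A B" "\<And>i j. i < n \<Longrightarrow> j < n \<Longrightarrow> A i j = A j i" "i < n" "j < n"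
  shows "B i j = B j i"
proof -
  have "is_inverse n A (\<lambda>i j. B j i)"
    unfolding is_inverse_def mmul_def
  proof (intro allI impI conjI)
    fix i j assume ij: "i < n" "j < n"
    have "(\<Sum>l<n. A i l * B j l) = (\<Sum>l<n. B j l * A l i)"
      using assms(2) ij by (intro sum.cong) (auto simp: mult.commute)
    thus "(\<Sum>l<n. A i l * B j l) = (if i = j then 1 else 0)"
      using is_inverseD(2)[OF assms(1) ij(2,1)] by auto
    have "(\<Sum>l<n. B l i * A l j) = (\<Sum>l<n. A j l * B l i)"
      using assms(2) ij by (intro sum.cong) (auto simp: mult.commute)
    thus "(\<Sum>l<n. B l i * A l j) = (if i = j then 1 else 0)"
      using is_inverseD(1)[OF assms(1) ij(2,1)] by auto
  qed
  from is_inverse_unique[OF assms(1) this assms(3,4)] show ?thesis .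
qed

lemma is_inverse_minv:
  assumes "is_inverse n A B"
  shows "is_inverse n A (minv n A)" "n \<le> i \<or> n \<le> j \<Longrightarrow> minv n A i j = 0"
proof -
  \<comment> \<open>Truncating a given inverse to the block yields a witness for both properties
    demanded by the choice operator in \<open>minv\<close>.\<close>
  define B' where "B' = (\<lambda>i j. if i < n \<and> j < n then B i j else 0)"
  have "is_inverse n A B'"
    using assms by (subst is_inverse_cong[where A' = A and B' = B]) (auto simp: B'_def)
  hence "is_inverse n A B' \<and> (\<forall>i j. n \<le> i \<or> n \<le> j \<longrightarrow> B' i j = 0)"
    by (auto simp: B'_def)
  hence *: "is_inverse n A (minv n A) \<and> (\<forall>i j. n \<le> i \<or> n \<le> j \<longrightarrow> minv n A i j = 0)"
    unfolding minv_def
    by (rule someI[of "\<lambda>B. is_inverse n A B \<and> (\<forall>i j. n \<le> i \<or> n \<le> j \<longrightarrow> B i j = 0)"])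
  thus "is_inverse n A (minv n A)" "n \<le> i \<or> n \<le> j \<Longrightarrow> minv n A i j = 0" by blast+
qed

lemma qform_inverse:
  assumes "is_inverse n G P"
  shows "qform n P y = qform n G (\<lambda>i. \<Sum>j<n. P i j * y j)"
proof -
  have "qform n G (\<lambda>i. \<Sum>j<n. P i j * y j) = (\<Sum>i<n. (\<Sum>j<n. P i j * y j) * y i)"
    unfolding qform_altdef by (intro sum.cong refl) (use is_inverse_apply[OF assms] in auto)
  thus ?thesis by (simp add: qform_altdef mult.commute)
qed

text \<open>Expand \<open>0 \<le> qform n A (z + t w)\<close> with \<open>w = A z\<close> and \<open>t\<close> small and negative.\<close>
lemma psd_null_vector:
  assumes psd: "\<And>y. 0 \<le> qform n A y" and sym: "\<And>i j. i < n \<Longrightarrow> j < n \<Longrightarrow> A i j = A j i"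
    and z: "qform n A z = 0" and i: "i < n"
  shows "(\<Sum>j<n. A i j * z j) = 0"
proof -
  define w where "w = (\<lambda>i. \<Sum>j<n. A i j * z j)"
  define s where "s = (\<Sum>i<n. w i * w i)"
  define c where "c = qform n A w"
  have c0: "c \<ge> 0" unfolding c_def by (rule psd)
  have expand: "qform n A (\<lambda>i. z i + t * w i) = 2 * t * s + t\<^sup>2 * c" for t
  proof -
    have "qform n A (\<lambda>i. z i + t * w i) = qform n A z + t * (\<Sum>i<n. \<Sum>j<n. z i * A i j * w j)
        + t * (\<Sum>i<n. \<Sum>j<n. w i * A i j * z j) + t\<^sup>2 * c"
      unfolding qform_def c_def by (simp add: sum_distrib_left sum.distrib[symmetric])
        (intro sum.cong refl, simp add: algebra_simps power2_eq_square)
    moreover have "(\<Sum>i<n. \<Sum>j<n. z i * A i j * w j) = (\<Sum>i<n. \<Sum>j<n. w i * A i j * z j)"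
      by (subst sum.swap) (intro sum.cong refl, use sym in auto)
    moreover have "(\<Sum>i<n. \<Sum>j<n. w i * A i j * z j) = s"
      unfolding s_def w_def by (simp add: sum_distrib_left mult.assoc)
    ultimately show ?thesis using z by simp
  qed
  \<comment> \<open>Evaluating at \<open>t = - x\<close> gives \<open>- (x ^ 2 * (c + 2))\<close>;
    the denominator \<open>c + 1\<close> stays positive also when \<open>c = 0\<close>.\<close>
  define x where "x = s / (c + 1)"
  have s: "s = x * (c + 1)" using c0 by (simp add: x_def)
  have "0 \<le> 2 * (- x) * s + (- x)\<^sup>2 * c"
    using psd[of "\<lambda>i. z i + (- x) * w i"] unfolding expand .
  also have "\<dots> = - (x\<^sup>2 * (c + 2))" unfolding s by (simp add: algebra_simps power2_eq_square)
  finally have "x\<^sup>2 * (c + 2) \<le> 0" by simp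
  hence "x = 0" using c0 by (auto simp: mult_le_0_iff)
  hence "s = 0" by (simp add: s)
  hence "\<forall>i\<in>{..<n}. w i * w i = 0" unfolding s_def by (subst (asm) sum_nonneg_eq_0_iff) auto
  thus ?thesis using i by (simp add: w_def)
qed

text \<open>Here \<open>u\<close> solves the leading system with the new column as right-hand side,
  and \<open>d\<close> is the Schur complement. The new inverse is \<open>B\<close>, padded by
  zeros, plus the rank-one matrix \<open>v v^T / d\<close> with \<open>v = (- u, 1)\<close>, so the
  quadratic form grows by a single square.\<close>

lemma is_inverse_border:
  fixes P B :: "nat \<Rightarrow> nat \<Rightarrow> real"
  assumes inv: "is_inverse k P B" and sym: "\<And>i j. i \<le> k \<Longrightarrow> j \<le> k \<Longrightarrow> P i j = P j i"
  defines "u \<equiv> \<lambda>i. \<Sum>j<k. B i j * P j k"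
  defines "d \<equiv> P k k - (\<Sum>i<k. P k i * u i)"
  defines "B' \<equiv> \<lambda>i j. if i < k then (if j < k then B i j + u i * u j / d else - u i / d)
                        else (if j < k then - u j / d else 1 / d)"
  assumes d: "d \<noteq> 0"
  shows "is_inverse (Suc k) P B'"
    and "qform (Suc k) B' y = qform k B y + (1 / d) * (y k - (\<Sum>i<k. u i * y i))\<^sup>2"
proof -
  have Bsym: "B i j = B j i" if "i < k" "j < k" for i j
    using is_inverse_symmetric[OF inv _ that] sym by simp
  have Pu: "(\<Sum>l<k. P i l * u l) = P i k" if "i < k" for i
    unfolding u_def using is_inverse_apply[OF inv that] .
  have PB: "(\<Sum>l<k. P k l * B l j) = u j" if "j < k" for j
    unfolding u_def using that Bsym sym by (intro sum.cong) (auto simp: mult.commute)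
  have PB': "(\<Sum>l<Suc k. P i l * B' l j) = (if i = j then 1 else 0)" if ij: "i < Suc k" "j < Suc k" for i j
  proof -
    consider "i < k" "j < k" | "i < k" "j = k" | "i = k" "j < k" | "i = k" "j = k" using ij by linarith
    thus ?thesis
    proof cases
      case 1
      have "(\<Sum>l<Suc k. P i l * B' l j) = (\<Sum>l<k. P i l * B l j + (P i l * u l) * (u j / d)) - P i k * (u j / d)"
        using 1 by (simp add: B'_def distrib_left mult.assoc)
      also have "\<dots> = (\<Sum>l<k. P i l * B l j)"
        by (simp only: sum.distrib sum_distrib_right[symmetric] Pu[OF 1(1)])
      finally show ?thesis using is_inverseD(1)[OF inv 1] by simp
    next
      case 2
      have "(\<Sum>l<Suc k. P i l * B' l j) = - (\<Sum>l<k. P i l * u l) / d + P i k / d"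
        using 2 by (simp add: B'_def sum_divide_distrib sum_negf)
      thus ?thesis using Pu[OF 2(1)] 2 by simp
    next
      case 3
      have "(\<Sum>l<Suc k. P i l * B' l j) = (\<Sum>l<k. P k l * B l j + (P k l * u l) * (u j / d)) - P k k * (u j / d)"
        using 3 by (simp add: B'_def distrib_left mult.assoc)
      also have "\<dots> = u j + (\<Sum>l<k. P k l * u l) * (u j / d) - P k k * (u j / d)"
        by (simp only: sum.distrib sum_distrib_right[symmetric] PB[OF 3(2)])
      also have "\<dots> = u j - d * (u j / d)" by (simp only: d_def left_diff_distrib)
      finally show ?thesis using d 3 by simp
    next
      case 4
      have "(\<Sum>l<Suc k. P i l * B' l j) = - (\<Sum>l<k. P k l * u l) / d + P k k / d"
        using 4 by (simp add: B'_def sum_divide_distrib sum_negf)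
      also have "\<dots> = (P k k - (\<Sum>l<k. P k l * u l)) / d" by (simp only: diff_divide_distrib)
      also have "\<dots> = d / d" by (simp only: d_def)
      finally show ?thesis using d 4 by simp
    qed
  qed
  have B'sym: "B' i j = B' j i" for i j
    unfolding B'_def using Bsym by auto
  show "is_inverse (Suc k) P B'"
    unfolding is_inverse_def mmul_def
  proof (intro allI impI conjI PB')
    fix i j assume ij: "i < Suc k" "j < Suc k"
    have "(\<Sum>l<Suc k. B' i l * P l j) = (\<Sum>l<Suc k. P j l * B' l i)"
      using ij sym by (intro sum.cong refl) (auto simp: B'sym[of i] mult.commute less_Suc_eq_le)
    also have "\<dots> = (if i = j then 1 else 0)" using PB'[OF ij(2,1)] by auto
    finally show "(\<Sum>l<Suc k. B' i l * P l j) = (if i = j then 1 else 0)" .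
  qed auto
  define U where "U = (\<Sum>i<k. u i * y i)"
  have "qform (Suc k) B' y = (\<Sum>i<k. \<Sum>j<k. y i * B i j * y j + (u i * y i) * (u j * y j) / d)
      + (\<Sum>i<k. - (u i * y i) * (y k / d)) + ((\<Sum>j<k. - (y k / d) * (u j * y j)) + y k * (y k / d))"
    unfolding qform_def by (simp add: B'_def sum.distrib algebra_simps)
  also have "(\<Sum>i<k. \<Sum>j<k. y i * B i j * y j + (u i * y i) * (u j * y j) / d) = qform k B y + U * U / d"
    by (simp add: sum.distrib qform_def U_def sum_product sum_divide_distrib)
  also have "(\<Sum>i<k. - (u i * y i) * (y k / d)) = - U * (y k / d)"
    unfolding U_def by (simp add: sum_distrib_right sum_negf sum_divide_distrib)
  also have "(\<Sum>j<k. - (y k / d) * (u j * y j)) = - (y k / d) * U"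
    unfolding U_def by (simp only: sum_distrib_left)
  also have "qform k B y + U * U / d + - U * (y k / d) + (- (y k / d) * U + y k * (y k / d))
      = qform k B y + (1 / d) * (y k - U)\<^sup>2"
    by (simp add: power2_eq_square algebra_simps add_divide_distrib diff_divide_distrib)
  finally show "qform (Suc k) B' y = qform k B y + (1 / d) * (y k - (\<Sum>i<k. u i * y i))\<^sup>2"
    unfolding U_def .
qed

section \<open>Completing squares along the leading minors of the inverse\<close>

lemma qform_cong:
  assumes "\<And>i j. i < n \<Longrightarrow> j < n \<Longrightarrow> A i j = B i j"
  shows "qform n A y = qform n B y"
  unfolding qform_def using assms by (intro sum.cong) auto

text \<open>A covariance form is directly seen to be only semidefinite; definiteness is recovered
  from the existence of an inverse in \<open>compl_pos\<close>.\<close>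

locale psd_inverse =
  fixes n :: nat and G P :: "nat \<Rightarrow> nat \<Rightarrow> real"
  assumes inv: "is_inverse n G P"
    and sym: "\<And>i j. i < n \<Longrightarrow> j < n \<Longrightarrow> G i j = G j i"
    and psd: "\<And>y. 0 \<le> qform n G y"
begin

text \<open>The inverse of the leading block of \<open>P\<close>, padded with zeros exactly as in
  \<open>schur_a\<close>, so that both refer to the same choice of inverse.\<close>

definition lead :: "nat \<Rightarrow> nat \<Rightarrow> nat \<Rightarrow> real" where
  "lead k = minv k (\<lambda>i j. if i < k \<and> j < k then P i j else 0)"

definition lin :: "nat \<Rightarrow> nat \<Rightarrow> real" where
  "lin k i = (\<Sum>j<k. lead k i j * P j k)"

definition compl :: "nat \<Rightarrow> real" where
  "compl k = P k k - (\<Sum>i<k. P k i * lin k i)"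

lemma P_sym: "i < n \<Longrightarrow> j < n \<Longrightarrow> P i j = P j i"
  using is_inverse_symmetric[OF inv sym] .

lemma P_psd: "0 \<le> qform n P y"
  unfolding qform_inverse[OF inv] by (rule psd)

lemma schur_a_compl: "schur_a P (Suc k) = 1 / compl k"
proof (cases "k = 0")
  case False
  have "(\<Sum>i<k. \<Sum>j<k. P k i * lead k i j * P j k) = (\<Sum>i<k. P k i * lin k i)"
    by (simp add: lin_def sum_distrib_left mult.assoc)
  thus ?thesis using False by (simp add: schur_a_def compl_def lead_def Let_def)
qed (simp add: schur_a_def compl_def)

text \<open>\<open>compl k\<close> is the value of the form \<open>P\<close> at
  \<open>z = (- lin k, 1, 0, ...)\<close>. Were it 0, then \<open>P z = 0\<close> by
  \<open>psd_null_vector\<close>, so \<open>z = G (P z) = 0\<close>, against \<open>z k = 1\<close>.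
  Likewise \<open>P k k - compl k\<close> is the value at \<open>(lin k, 0, ...)\<close>, hence
  nonnegative; this upper bound turns the bound on the entries of \<Psi> into a lower bound on the
  Schur numbers.\<close>

lemma compl_pos:
  assumes k: "k < n" and inv_k: "is_inverse k P (lead k)"
  shows "0 < compl k" "compl k \<le> P k k"
proof -
  have Pl: "(\<Sum>l<k. P i l * lin k l) = P i k" if "i < k" for i
    unfolding lin_def using is_inverse_apply[OF inv_k that] .
  have split: "(\<Sum>j<n. f j) = (\<Sum>j<k. f j) + f k" if "\<And>j. k < j \<Longrightarrow> f j = 0" for f :: "nat \<Rightarrow> real"
  proof -
    have "(\<Sum>j<n. f j) = (\<Sum>j<Suc k. f j)"
      by (rule sum.mono_neutral_right) (use k that in auto)
    thus ?thesis by simp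
  qed
  define z where "z = (\<lambda>i. if i < k then - lin k i else if i = k then 1 else 0)"
  have Pz: "(\<Sum>j<n. P i j * z j) = P i k - (\<Sum>l<k. P i l * lin k l)" for i
    by (subst split) (auto simp: z_def sum_negf)
  have "qform n P z = (\<Sum>i<k. z i * (\<Sum>j<n. P i j * z j)) + z k * (\<Sum>j<n. P k j * z j)"
    unfolding qform_altdef by (rule split) (auto simp: z_def)
  also have "(\<Sum>i<k. z i * (\<Sum>j<n. P i j * z j)) = 0"
    by (intro sum.neutral) (auto simp: Pz Pl)
  also have "z k * (\<Sum>j<n. P k j * z j) = compl k"
    by (simp add: Pz compl_def) (simp add: z_def)
  finally have qz: "qform n P z = compl k" by simp
  have "compl k \<noteq> 0"
  proof
    assume "compl k = 0"
    hence "(\<Sum>j<n. P i j * z j) = 0" if "i < n" for i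
      using psd_null_vector[OF P_psd P_sym _ that] qz by simp
    hence "(\<Sum>j<n. G k j * (\<Sum>l<n. P j l * z l)) = 0" by simp
    thus False using is_inverse_apply[OF inv k, of z] by (simp add: z_def)
  qed
  thus "0 < compl k" using P_psd[of z] unfolding qz by simp
  define w where "w = (\<lambda>i. if i < k then lin k i else 0)"
  have "qform n P w = (\<Sum>i<k. lin k i * (\<Sum>j<n. P i j * w j))"
    unfolding qform_altdef by (subst split) (auto simp: w_def)
  also have "\<dots> = (\<Sum>i<k. P k i * lin k i)"
  proof (intro sum.cong refl)
    fix i assume "i \<in> {..<k}"
    hence "(\<Sum>j<n. P i j * w j) = P i k" by (subst split) (auto simp: w_def Pl)
    thus "lin k i * (\<Sum>j<n. P i j * w j) = P k i * lin k i"
      using P_sym[of i k] k \<open>i \<in> {..<k}\<close> by simp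
  qed
  finally show "compl k \<le> P k k" using P_psd[of w] by (simp add: compl_def)
qed

lemma lead_step:
  assumes k: "k < n" and inv_k: "is_inverse k P (lead k)"
  shows "is_inverse (Suc k) P (lead (Suc k))"
    and "qform (Suc k) (lead (Suc k)) y =
           qform k (lead k) y + schur_a P (Suc k) * (y k - (\<Sum>i<k. lin k i * y i))\<^sup>2"
proof -
  define B' where "B' = (\<lambda>i j. if i < k then (if j < k then lead k i j + lin k i * lin k j / compl k else - lin k i / compl k)
                        else (if j < k then - lin k j / compl k else 1 / compl k))"
  have d: "compl k \<noteq> 0" using compl_pos[OF assms] by simp
  have s: "P i j = P j i" if "i \<le> k" "j \<le> k" for i j using P_sym k that by simp
  note border = is_inverse_border[OF inv_k s, folded lin_def, folded compl_def, OF _ _ d, folded B'_def]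
  have 1: "is_inverse (Suc k) P B'" using border(1) by simp
  have "is_inverse (Suc k) (\<lambda>i j. if i < Suc k \<and> j < Suc k then P i j else 0) B'"
    using 1 by (subst is_inverse_cong[where A' = P and B' = B']) auto
  from is_inverse_minv(1)[OF this]
  have "is_inverse (Suc k) (\<lambda>i j. if i < Suc k \<and> j < Suc k then P i j else 0) (lead (Suc k))"
    unfolding lead_def .
  thus 2: "is_inverse (Suc k) P (lead (Suc k))"
    by (subst is_inverse_cong[where A' = "\<lambda>i j. if i < Suc k \<and> j < Suc k then P i j else 0"
          and B' = "lead (Suc k)"]) auto
  have "qform (Suc k) (lead (Suc k)) y = qform (Suc k) B' y"
    by (rule qform_cong) (rule is_inverse_unique[OF 2 1])
  also have "\<dots> = qform k (lead k) y + schur_a P (Suc k) * (y k - (\<Sum>i<k. lin k i * y i))\<^sup>2"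
    using border(2) by (simp add: schur_a_compl)
  finally show "qform (Suc k) (lead (Suc k)) y =
           qform k (lead k) y + schur_a P (Suc k) * (y k - (\<Sum>i<k. lin k i * y i))\<^sup>2" .
qed

lemma lead_inverse: "k \<le> n \<Longrightarrow> is_inverse k P (lead k)"
  by (induction k) (auto simp: is_inverse_def[of 0] intro: lead_step(1))

lemma schur_a_pos:
  assumes "k < n"
  shows "0 < schur_a P (Suc k)" "1 / schur_a P (Suc k) \<le> P k k"
  using compl_pos[OF assms lead_inverse] assms by (auto simp: schur_a_compl)

text \<open>\<open>G\<close> agrees with \<open>lead n\<close> by uniqueness of the inverse of
  \<open>P\<close>; unrolling \<open>lead_step\<close> from the empty form at \<open>k = 0\<close>
  leaves only squares.\<close>

lemma qform_squares:
  "qform n G y = (\<Sum>k<n. schur_a P (Suc k) * (y k - (\<Sum>i<k. lin k i * y i))\<^sup>2)"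
proof -
  have "qform k (lead k) y = (\<Sum>k<k. schur_a P (Suc k) * (y k - (\<Sum>i<k. lin k i * y i))\<^sup>2)" if "k \<le> n" for k
    using that by (induction k) (simp_all add: lead_step(2)[OF _ lead_inverse] qform_def[of 0])
  moreover have "qform n G y = qform n (lead n) y"
    by (rule qform_cong) (rule is_inverse_unique[OF is_inverse_commute[OF inv] lead_inverse], auto)
  ultimately show ?thesis by simp
qed

end

subsection \<open>Characters of the discrete torus\<close>

lemma redq_eq:
  obtains k where "redq q x = x + int q * k"
proof
  show "redq q x = x + int q * (- ((x + int q div 2) div int q))"
    unfolding redq_def by (simp add: minus_div_mult_eq_mod[symmetric] algebra_simps)
qed

lemma redq_bounds:
  assumes "q > 0"
  shows "- int q \<le> 2 * redq q x" "2 * redq q x < int q"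
proof -
  define m p where "m = (x + int q div 2) mod int q" and "p = int q div 2"
  have "0 \<le> m" "m < int q" "2 * p \<le> int q" "int q \<le> 2 * p + 1"
    using assms by (simp_all add: m_def p_def)
  moreover have "redq q x = m - p" by (simp add: redq_def m_def p_def)
  ultimately show "- int q \<le> 2 * redq q x" "2 * redq q x < int q" by simp_all
qed

lemma reps_residue_unique:
  fixes a b :: int
  assumes "- int q \<le> 2 * a" "2 * a < int q" "- int q \<le> 2 * b" "2 * b < int q" "int q dvd a - b"
  shows "a = b"
proof -
  have "\<bar>a - b\<bar> < int q" using assms by linarith
  thus ?thesis using assms(5) dvd_imp_le_int[of "a - b" "int q"] by fastforce
qed

lemma reps_eqI:
  assumes "x \<in> reps q n" "y \<in> reps q n" "\<And>i. i < n \<Longrightarrow> int q dvd x i - y i"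
  shows "x = y"
proof
  fix i show "x i = y i"
  proof (cases "i < n")
    case True
    show ?thesis
      by (rule reps_residue_unique[of q]) (use assms True in \<open>auto simp: reps_def\<close>)
  qed (use assms in \<open>auto simp: reps_def\<close>)
qed

lemma redq_dvd: "int q dvd redq q x - x"
  by (rule redq_eq[of q x]) simp

lemma
  assumes "q > 0"
  shows addq_in_reps: "addq q n x y \<in> reps q n"
    and subq_in_reps: "subq q n x y \<in> reps q n"
    and negq_in_reps: "negq q n x \<in> reps q n"
  using redq_bounds[OF assms] by (auto simp: reps_def addq_def subq_def negq_def)

lemma zero_in_reps: "q > 0 \<Longrightarrow> (\<lambda>_. 0) \<in> reps q n"
  by (simp add: reps_def)

section \<open>Building the representatives coordinate by coordinate\<close>

definition int_box :: "nat \<Rightarrow> int set" where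
  "int_box q = {m. - int q \<le> 2 * m \<and> 2 * m < int q}"

lemma finite_int_box: "finite (int_box q)"
  by (rule finite_subset[of _ "{- int q..int q}"]) (auto simp: int_box_def)

lemma reps_0: "reps q 0 = {\<lambda>_. 0}"
  by (auto simp: reps_def)

lemma reps_Suc: "reps q (Suc n) = (\<lambda>(y, m). y(n := m)) ` (reps q n \<times> int_box q)"
proof (intro set_eqI iffI)
  fix y assume y: "y \<in> reps q (Suc n)"
  have "y(n := 0) \<in> reps q n" "y n \<in> int_box q" using y by (auto simp: reps_def int_box_def)
  moreover have "y = (\<lambda>(y, m). y(n := m)) (y(n := 0), y n)" by auto
  ultimately show "y \<in> (\<lambda>(y, m). y(n := m)) ` (reps q n \<times> int_box q)" by blast
qed (auto simp: reps_def int_box_def less_Suc_eq)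

lemma finite_reps: "finite (reps q n)"
  by (induction n) (simp_all add: reps_0 reps_Suc finite_int_box)

lemma sum_reps_Suc: "(\<Sum>y\<in>reps q (Suc n). f y) = (\<Sum>y\<in>reps q n. \<Sum>m\<in>int_box q. f (y(n := m)))"
proof -
  have "inj_on (\<lambda>(y, m). y(n := m)) (reps q n \<times> int_box q)"
  proof (rule inj_onI, clarify)
    fix y m y' m' assume 1: "y \<in> reps q n" "y' \<in> reps q n" and eq: "y(n := m) = y'(n := m')"
    have "m = m'" using fun_cong[OF eq, of n] by simp
    moreover have "y i = y' i" for i
      using fun_cong[OF eq, of i] 1 by (cases "i = n") (auto simp: reps_def)
    ultimately show "y = y' \<and> m = m'" by auto
  qed
  thus ?thesis
    unfolding reps_Suc sum.cartesian_product by (subst sum.reindex) (auto simp: o_def split_def)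
qed

text \<open>Frequency and point may be arbitrary integer vectors, so that sums and differences need
  no reduction modulo \<open>q\<close>; \<open>chi_cong\<close> supplies the invariance under
  reduction.\<close>

definition chi :: "nat \<Rightarrow> nat \<Rightarrow> (nat \<Rightarrow> int) \<Rightarrow> (nat \<Rightarrow> int) \<Rightarrow> complex" where
  "chi q n w x = cis (2 * pi * real_of_int (\<Sum>i<n. w i * x i) / real q)"

lemma chi_commute: "chi q n w x = chi q n x w"
  by (simp add: chi_def mult.commute)

lemma chi_add: "chi q n w (\<lambda>i. x i + y i) = chi q n w x * chi q n w y"
  by (simp add: chi_def cis_mult sum.distrib distrib_left add_divide_distrib)

lemma chi_uminus: "chi q n w (\<lambda>i. - x i) = cnj (chi q n w x)"
  by (simp add: chi_def cis_cnj sum_negf)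

lemma chi_zero [simp]: "chi q n (\<lambda>_. 0) x = 1" "chi q n w (\<lambda>_. 0) = 1"
  by (simp_all add: chi_def)

lemma chi_mult_cnj [simp]: "chi q n w x * cnj (chi q n w x) = 1"
  by (simp add: chi_def complex_mult_cnj cis_cnj cis_mult)

lemma cis_2pi_int_multiple: "cis (2 * pi * real_of_int k) = 1"
  by (rule complex_eqI) (simp_all add: cos_int_2pin sin_int_2pin)

lemma chi_cong:
  assumes q: "q > 0" and "\<And>i. i < n \<Longrightarrow> int q dvd x i - y i"
  shows "chi q n w x = chi q n w y"
proof -
  have "int q dvd (\<Sum>i<n. w i * (x i - y i))" using assms(2) by (intro dvd_sum) auto
  then obtain k where k: "(\<Sum>i<n. w i * (x i - y i)) = int q * k" by (elim dvdE)
  have "chi q n w (\<lambda>i. x i - y i) = 1"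
    unfolding chi_def k using q cis_2pi_int_multiple[of k] by (simp add: mult.assoc)
  thus ?thesis using chi_add[of q n w "\<lambda>i. x i - y i" y] by simp
qed

lemma chi_addq: "q > 0 \<Longrightarrow> chi q n w (addq q n x y) = chi q n w x * chi q n w y"
  unfolding chi_add[symmetric] by (rule chi_cong) (auto simp: addq_def redq_dvd)

lemma chi_negq: "q > 0 \<Longrightarrow> chi q n w (negq q n x) = cnj (chi q n w x)"
proof -
  assume q: "q > 0"
  have "chi q n w (negq q n x) = chi q n w (\<lambda>i. - x i)"
    by (rule chi_cong[OF q]) (simp only: negq_def if_True redq_dvd)
  thus ?thesis by (simp add: chi_uminus)
qed

lemma bij_subq:
  assumes "q > 0"
  shows "bij_betw (\<lambda>z. subq q n z x) (reps q n) (reps q n)"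
    and "\<And>z. z \<in> reps q n \<Longrightarrow> addq q n (subq q n z x) x = z"
proof -
  have 1: "addq q n (subq q n z x) x = z" if "z \<in> reps q n" for z
  proof (rule reps_eqI[OF addq_in_reps[OF assms] that])
    fix i assume "i < n"
    have "int q dvd (redq q (redq q (z i - x i) + x i) - (redq q (z i - x i) + x i)) + (redq q (z i - x i) - (z i - x i))"
      by (intro dvd_add redq_dvd)
    thus "int q dvd addq q n (subq q n z x) x i - z i" using \<open>i < n\<close> by (simp add: addq_def subq_def)
  qed
  have 2: "subq q n (addq q n z x) x = z" if "z \<in> reps q n" for z
  proof (rule reps_eqI[OF subq_in_reps[OF assms] that])
    fix i assume "i < n"
    have "int q dvd (redq q (redq q (z i + x i) - x i) - (redq q (z i + x i) - x i)) + (redq q (z i + x i) - (z i + x i))"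
      by (intro dvd_add redq_dvd)
    thus "int q dvd subq q n (addq q n z x) x i - z i" using \<open>i < n\<close> by (simp add: addq_def subq_def)
  qed
  show "bij_betw (\<lambda>z. subq q n z x) (reps q n) (reps q n)"
    by (rule bij_betwI[where g = "\<lambda>z. addq q n z x"]) (auto simp: 1 2 subq_in_reps addq_in_reps assms)
  show "\<And>z. z \<in> reps q n \<Longrightarrow> addq q n (subq q n z x) x = z" by (rule 1)
qed

lemma bij_negq:
  assumes "q > 0"
  shows "bij_betw (negq q n) (reps q n) (reps q n)"
proof -
  have 1: "negq q n (negq q n z) = z" if "z \<in> reps q n" for z
  proof (rule reps_eqI[OF negq_in_reps[OF assms] that])
    fix i assume "i < n"
    have "int q dvd (redq q (- redq q (- z i)) - (- redq q (- z i))) - (redq q (- z i) - (- z i))"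
      by (intro dvd_diff redq_dvd)
    thus "int q dvd negq q n (negq q n z) i - z i" using \<open>i < n\<close> by (simp add: negq_def)
  qed
  show ?thesis
    by (rule bij_betwI[where g = "negq q n"]) (auto simp: 1 negq_in_reps assms)
qed

text \<open>Translating by \<open>s\<close> multiplies the sum by \<open>chi q n w s\<close>, so the
  sum vanishes once some shift has character value different from 1. If \<open>q\<close> does not
  divide \<open>w i\<close>, the negative of the \<open>i\<close>-th unit vector is such a
  shift.\<close>

lemma sum_chi:
  assumes q: "q > 0"
  shows "(\<Sum>x\<in>reps q n. chi q n w x) = (if \<forall>i<n. int q dvd w i then of_nat (card (reps q n)) else 0)"
proof (cases "\<forall>i<n. int q dvd w i")
  case True
  hence "chi q n x w = chi q n x (\<lambda>_. 0)" for x by (intro chi_cong[OF q]) auto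
  hence "chi q n w x = 1" for x by (subst chi_commute) simp
  thus ?thesis using True by simp
next
  case False
  then obtain i where i: "i < n" "\<not> int q dvd w i" by blast
  define s :: "nat \<Rightarrow> int" where "s = (\<lambda>j. if j = i then - 1 else 0)"
  have "(\<Sum>j<n. w j * s j) = - w i"
    using i(1) by (simp add: s_def if_distrib cong: if_cong)
  hence chis: "chi q n w s = cis (2 * pi * real_of_int (- w i) / real q)" by (simp add: chi_def)
  have ne: "chi q n w s \<noteq> 1"
  proof
    assume "chi q n w s = 1"
    hence "cos (2 * pi * real_of_int (- w i) / real q) = 1" unfolding chis by (simp add: complex_eq_iff)
    then obtain k :: int where "2 * pi * real_of_int (- w i) / real q = real_of_int k * 2 * pi"
      unfolding cos_one_2pi_int by auto
    hence "2 * pi * real_of_int (- w i) = 2 * pi * real_of_int (k * int q)"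
      using q by (simp add: field_simps)
    hence "real_of_int (- w i) = real_of_int (k * int q)" by (subst (asm) mult_left_cancel) auto
    hence "- w i = k * int q" by (simp only: of_int_eq_iff)
    hence "int q dvd - w i" by simp
    thus False using i(2) by simp
  qed
  have "(\<Sum>x\<in>reps q n. chi q n w x) = (\<Sum>x\<in>reps q n. chi q n w (addq q n (subq q n x s) s))"
    by (intro sum.cong refl) (simp add: bij_subq(2)[OF q])
  also have "\<dots> = (\<Sum>x\<in>reps q n. chi q n w (addq q n x s))"
    by (rule sum.reindex_bij_betw[OF bij_subq(1)[OF q]])
  also have "\<dots> = (\<Sum>x\<in>reps q n. chi q n w x) * chi q n w s"
    by (simp add: chi_addq q sum_distrib_right)
  finally have "(\<Sum>x\<in>reps q n. chi q n w x) * (1 - chi q n w s) = 0" by (simp add: algebra_simps)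
  hence "(\<Sum>x\<in>reps q n. chi q n w x) = 0" using ne by auto
  thus ?thesis using False by auto
qed

lemma chi_orthogonal:
  assumes q: "q > 0" and "x \<in> reps q n" "z \<in> reps q n"
  shows "(\<Sum>w\<in>reps q n. chi q n w x * cnj (chi q n w z)) = (if x = z then of_nat (card (reps q n)) else 0)"
proof -
  have "chi q n w x * cnj (chi q n w z) = chi q n (\<lambda>i. x i - z i) w" for w
    using chi_add[of q n w x "\<lambda>i. - z i"] by (simp add: chi_uminus chi_commute[of q n _ w])
  moreover have "(\<forall>i<n. int q dvd x i - z i) \<longleftrightarrow> x = z"
    using reps_eqI[OF assms(2,3)] by auto
  ultimately show ?thesis by (simp add: sum_chi[OF q])
qed

subsection \<open>Spectral representation of the walk\<close>

locale torus_walk =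
  fixes q n :: nat and mu :: "(nat \<Rightarrow> int) \<Rightarrow> real"
  assumes q_pos: "q > 0" and walk: "sym_walk_measure q n mu"
begin

abbreviation "A \<equiv> reps q n"
abbreviation "N \<equiv> real (card A)"

text \<open>The eigenvalue of the transition matrix on the character of frequency \<open>w\<close>
  (see \<open>sum_Q_chi\<close> with \<open>c = 0\<close>).\<close>

definition Lam :: "(nat \<Rightarrow> int) \<Rightarrow> real" where
  "Lam w = Phi_mu q n mu (\<lambda>i. 2 * pi * real_of_int (w i) / real q)"

lemma mu_nonneg: "0 \<le> mu y" and mu_sum: "(\<Sum>y\<in>A. mu y) = 1"
  and mu_neg: "y \<in> A \<Longrightarrow> mu (negq q n y) = mu y"
  and gen: "gen_by q n {y\<in>A. mu y > 0} = A"
  using walk by (auto simp: sym_walk_measure_def)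

lemma N_pos: "N > 0"
  using zero_in_reps[OF q_pos] finite_reps by (auto simp: card_gt_0_iff)

lemma cis_chi: "cis (\<Sum>i<n. 2 * pi * real_of_int (w i) / real q * real_of_int (y i)) = chi q n w y"
  by (simp add: chi_def sum_distrib_left sum_divide_distrib mult_ac)

text \<open>Reindexing by negation turns the sum into its own complex conjugate, so taking the real
  part in \<open>Phi_mu\<close> loses nothing.\<close>

lemma sum_mu_chi: "(\<Sum>y\<in>A. complex_of_real (mu y) * chi q n w y) = complex_of_real (Lam w)"
proof -
  let ?S = "\<Sum>y\<in>A. complex_of_real (mu y) * chi q n w y"
  have "?S = (\<Sum>y\<in>A. complex_of_real (mu (negq q n y)) * chi q n w (negq q n y))"
    by (rule sum.reindex_bij_betw[OF bij_negq[OF q_pos], symmetric])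
  also have "\<dots> = (\<Sum>y\<in>A. complex_of_real (mu y) * cnj (chi q n w y))"
    by (intro sum.cong refl) (simp add: mu_neg chi_negq q_pos)
  also have "\<dots> = cnj ?S" by simp
  finally have "Im ?S = Im (cnj ?S)" by (rule arg_cong)
  hence "Im ?S = 0" by (simp only: cnj.sel)
  moreover have "Re ?S = Lam w" unfolding Lam_def Phi_mu_def cis_chi ..
  ultimately show ?thesis by (simp add: complex_eq_iff)
qed

lemma Lam_eq: "Lam w = (\<Sum>y\<in>A. mu y * Re (chi q n w y))"
  using arg_cong[OF sum_mu_chi[of w], of Re] by simp

lemma Re_chi_le_1: "Re (chi q n w x) \<le> 1"
  by (simp add: chi_def)

lemma Lam_0: "Lam (\<lambda>_. 0) = 1"
  by (simp add: Lam_eq mu_sum)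

text \<open>An average of real parts that are at most 1 equals 1 only if the character is 1 on the
  support. It is then 1 on everything the support generates, that is on the whole group, and
  \<open>sum_chi\<close> forces \<open>w = 0\<close>.\<close>

lemma Lam_lt_1:
  assumes w: "w \<in> A" "w \<noteq> (\<lambda>_. 0)"
  shows "Lam w < 1"
proof (rule ccontr)
  assume "\<not> Lam w < 1"
  have nonneg: "0 \<le> mu y * (1 - Re (chi q n w y))" for y
    by (intro mult_nonneg_nonneg mu_nonneg) (simp add: Re_chi_le_1)
  have "(\<Sum>y\<in>A. mu y * (1 - Re (chi q n w y))) = 1 - Lam w"
    by (simp add: Lam_eq right_diff_distrib sum_subtractf mu_sum)
  hence "(\<Sum>y\<in>A. mu y * (1 - Re (chi q n w y))) = 0"
    using \<open>\<not> Lam w < 1\<close> sum_nonneg[of A "\<lambda>y. mu y * (1 - Re (chi q n w y))"] nonneg by force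
  hence *: "mu y * (1 - Re (chi q n w y)) = 0" if "y \<in> A" for y
    using that nonneg by (subst (asm) sum_nonneg_eq_0_iff) (auto simp: finite_reps)
  have one: "chi q n w y = 1" if "y \<in> A" "mu y > 0" for y
  proof -
    have c: "Re (chi q n w y) = 1" using *[OF that(1)] that(2) by simp
    have "(Re (chi q n w y))\<^sup>2 + (Im (chi q n w y))\<^sup>2 = 1"
      by (simp add: chi_def)
    thus ?thesis using c by (simp add: complex_eq_iff)
  qed
  have "chi q n w x = 1" if "x \<in> gen_by q n {y\<in>A. mu y > 0}" for x
    using that by induction (auto simp: chi_addq q_pos one)
  hence "(\<Sum>x\<in>A. chi q n w x) = (\<Sum>x\<in>A. 1)" by (intro sum.cong) (auto simp: gen)
  hence "\<forall>i<n. int q dvd w i - 0"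
    using sum_chi[OF q_pos, of n w] N_pos by (auto split: if_splits)
  hence "w = (\<lambda>_. 0)" using w(1) zero_in_reps[OF q_pos] by (intro reps_eqI) auto
  thus False using w(2) by simp
qed

text \<open>The shift \<open>c\<close> allows one computation to serve two series:
  \<open>c = 1\<close> is the generator in \<open>Hker\<close>, and \<open>c = 0\<close> is the
  nonnegative matrix behind \<open>Hker_nonneg\<close>.\<close>

definition Q :: "real \<Rightarrow> (nat \<Rightarrow> int) \<Rightarrow> (nat \<Rightarrow> int) \<Rightarrow> real" where
  "Q c = (\<lambda>a b. Pmat q n mu a b - c * (if a = b then 1 else 0))"

lemma sum_Q_chi:
  assumes "x \<in> A"
  shows "(\<Sum>z\<in>A. complex_of_real (Q c x z) * chi q n w z) = complex_of_real (Lam w - c) * chi q n w x"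
proof -
  have "(\<Sum>z\<in>A. complex_of_real (Pmat q n mu x z) * chi q n w z)
      = (\<Sum>z\<in>A. complex_of_real (mu (subq q n z x)) * chi q n w (addq q n (subq q n z x) x))"
    by (intro sum.cong refl) (simp add: Pmat_def bij_subq(2)[OF q_pos])
  also have "\<dots> = (\<Sum>y\<in>A. complex_of_real (mu y) * chi q n w (addq q n y x))"
    by (rule sum.reindex_bij_betw[OF bij_subq(1)[OF q_pos]])
  also have "\<dots> = (\<Sum>y\<in>A. complex_of_real (mu y) * chi q n w y) * chi q n w x"
    by (simp add: chi_addq q_pos sum_distrib_right mult.assoc)
  finally have 1: "(\<Sum>z\<in>A. complex_of_real (Pmat q n mu x z) * chi q n w z) = complex_of_real (Lam w) * chi q n w x"
    by (simp only: sum_mu_chi)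
  have "(\<Sum>z\<in>A. complex_of_real (c * (if x = z then 1 else 0)) * chi q n w z)
      = (\<Sum>z\<in>A. if x = z then complex_of_real c * chi q n w z else 0)"
    by (intro sum.cong) auto
  also have "\<dots> = complex_of_real c * chi q n w x" using assms by (simp add: finite_reps)
  finally show ?thesis using 1
    unfolding Q_def of_real_diff left_diff_distrib sum_subtractf by simp
qed

lemma sum_fmpow_chi:
  assumes "x \<in> A"
  shows "(\<Sum>z\<in>A. complex_of_real (fmpow A (Q c) k x z) * chi q n w z) = complex_of_real (Lam w - c) ^ k * chi q n w x"
  using assms
proof (induction k arbitrary: x)
  case 0
  have "(\<Sum>z\<in>A. complex_of_real (fmpow A (Q c) 0 x z) * chi q n w z) = (\<Sum>z\<in>A. if x = z then chi q n w z else 0)"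
    by (intro sum.cong) auto
  thus ?case using 0 by (simp add: finite_reps)
next
  case (Suc k)
  have "(\<Sum>z\<in>A. complex_of_real (fmpow A (Q c) (Suc k) x z) * chi q n w z)
      = (\<Sum>y\<in>A. complex_of_real (Q c x y) * (\<Sum>z\<in>A. complex_of_real (fmpow A (Q c) k y z) * chi q n w z))"
    by (simp add: sum_distrib_left sum_distrib_right mult.assoc) (rule sum.swap)
  also have "\<dots> = (\<Sum>y\<in>A. complex_of_real (Q c x y) * chi q n w y) * complex_of_real (Lam w - c) ^ k"
    unfolding sum_distrib_right by (intro sum.cong refl) (simp only: Suc.IH, simp only: mult_ac)
  also have "\<dots> = complex_of_real (Lam w - c) ^ Suc k * chi q n w x"
    unfolding sum_Q_chi[OF Suc.prems] by simp
  finally show ?case .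
qed

lemma fmpow_complex:
  assumes "x \<in> A" "z \<in> A"
  shows "complex_of_real (fmpow A (Q c) k x z) =
          (\<Sum>w\<in>A. complex_of_real (Lam w - c) ^ k * (chi q n w x * cnj (chi q n w z))) / of_nat (card A)"
  using assms
proof (induction k arbitrary: x)
  case 0
  show ?case using chi_orthogonal[OF q_pos 0] N_pos by simp
next
  case (Suc k)
  have "complex_of_real (fmpow A (Q c) (Suc k) x z) = (\<Sum>y\<in>A. complex_of_real (Q c x y) *
          ((\<Sum>w\<in>A. complex_of_real (Lam w - c) ^ k * (chi q n w y * cnj (chi q n w z))) / of_nat (card A)))"
    using Suc by simp
  also have "\<dots> = (\<Sum>w\<in>A. \<Sum>y\<in>A. (complex_of_real (Q c x y) * chi q n w y) * (complex_of_real (Lam w - c) ^ k * cnj (chi q n w z))) / of_nat (card A)"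
    by (subst sum.swap) (simp add: sum_distrib_left sum_divide_distrib mult_ac)
  also have "\<dots> = (\<Sum>w\<in>A. complex_of_real (Lam w - c) ^ Suc k * (chi q n w x * cnj (chi q n w z))) / of_nat (card A)"
    unfolding sum_distrib_right[symmetric] sum_Q_chi[OF Suc.prems(1)] by (simp add: mult_ac)
  finally show ?case .
qed

lemma fmpow_real:
  assumes "x \<in> A" "z \<in> A"
  shows "fmpow A (Q c) k x z = (\<Sum>w\<in>A. (Lam w - c) ^ k * Re (chi q n w x * cnj (chi q n w z))) / N"
proof -
  have "Re (complex_of_real (fmpow A (Q c) k x z)) = (\<Sum>w\<in>A. Re (complex_of_real ((Lam w - c) ^ k) * (chi q n w x * cnj (chi q n w z)))) / N"
    unfolding fmpow_complex[OF assms] by (simp del: times_complex.sel)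
  moreover have "Re (complex_of_real a * c) = a * Re c" for a c by simp
  ultimately show ?thesis by (simp only: Re_complex_of_real)
qed

section \<open>The heat kernel in characters\<close>

abbreviation "H \<equiv> Hker q n mu"

lemma exp_series_fmpow:
  assumes "x \<in> A" "z \<in> A"
  shows "(\<lambda>k. t ^ k / fact k * fmpow A (Q c) k x z) sums
           ((\<Sum>w\<in>A. exp (t * (Lam w - c)) * Re (chi q n w x * cnj (chi q n w z))) / N)"
proof -
  have "(\<lambda>k. (\<Sum>w\<in>A. ((t * (Lam w - c)) ^ k /\<^sub>R fact k) * Re (chi q n w x * cnj (chi q n w z))) / N) sums
          ((\<Sum>w\<in>A. exp (t * (Lam w - c)) * Re (chi q n w x * cnj (chi q n w z))) / N)"
    by (intro sums_divide sums_sum sums_mult2 exp_converges)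
  moreover have "(\<Sum>w\<in>A. ((t * (Lam w - c)) ^ k /\<^sub>R fact k) * Re (chi q n w x * cnj (chi q n w z))) / N
      = t ^ k / fact k * fmpow A (Q c) k x z" for k
    unfolding fmpow_real[OF assms]
    by (simp add: sum_distrib_left power_mult_distrib divide_inverse mult_ac del: times_complex.sel)
  ultimately show ?thesis by simp
qed

lemma Hker_Q: "H t x z = (\<Sum>k. t ^ k / fact k * fmpow A (Q 1) k x z)"
  unfolding Hker_def Q_def by simp

lemma Hker_sums:
  assumes "x \<in> A" "z \<in> A"
  shows "(\<lambda>k. t ^ k / fact k * fmpow A (Q 1) k x z) sums H t x z"
  unfolding Hker_Q using exp_series_fmpow[OF assms, of t 1] by (simp add: sums_iff)

lemma Hker_eq:
  assumes "x \<in> A" "z \<in> A"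
  shows "H t x z = (\<Sum>w\<in>A. exp (t * (Lam w - 1)) * Re (chi q n w x * cnj (chi q n w z))) / N"
  using sums_unique2[OF Hker_sums[OF assms] exp_series_fmpow[OF assms]] .

text \<open>The series for \<open>H t\<close> has terms of both signs. Multiplying by
  \<open>exp t\<close> gives the exponential of \<open>t\<close> times the transition matrix itself,
  whose series has only nonnegative terms.\<close>

lemma Hker_nonneg:
  assumes "x \<in> A" "z \<in> A" "t \<ge> 0"
  shows "H t x z \<ge> 0"
proof -
  have pow: "fmpow A (Q 0) k a b \<ge> 0" for k a b
    by (induction k arbitrary: a) (auto intro!: sum_nonneg mult_nonneg_nonneg simp: Q_def Pmat_def mu_nonneg)
  have "exp t * H t x z = (\<Sum>w\<in>A. exp (t * (Lam w - 0)) * Re (chi q n w x * cnj (chi q n w z))) / N"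
    unfolding Hker_eq[OF assms(1,2)] times_divide_eq_right sum_distrib_left mult.assoc[symmetric] exp_add[symmetric]
    by (simp add: algebra_simps del: times_complex.sel)
  moreover have "\<dots> \<ge> 0"
    by (rule sums_le[OF _ sums_zero exp_series_fmpow[OF assms(1,2), of t 0]])
      (use assms(3) pow in simp)
  ultimately have "0 \<le> exp t * H t x z" by simp
  thus ?thesis by (simp add: zero_le_mult_iff)
qed

lemma sum_Hker_chi:
  assumes x: "x \<in> A"
  shows "(\<Sum>z\<in>A. complex_of_real (H t x z) * chi q n w z) = complex_of_real (exp (t * (Lam w - 1))) * chi q n w x"
proof -
  have "(\<lambda>k. \<Sum>z\<in>A. complex_of_real (t ^ k / fact k * fmpow A (Q 1) k x z) * chi q n w z) sums
          (\<Sum>z\<in>A. complex_of_real (H t x z) * chi q n w z)"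
    using x by (intro sums_sum sums_mult2 sums_of_real Hker_sums)
  moreover have "(\<Sum>z\<in>A. complex_of_real (t ^ k / fact k * fmpow A (Q 1) k x z) * chi q n w z)
      = complex_of_real ((t * (Lam w - 1)) ^ k /\<^sub>R fact k) * chi q n w x" for k
  proof -
    have "(\<Sum>z\<in>A. complex_of_real (t ^ k / fact k * fmpow A (Q 1) k x z) * chi q n w z)
       = complex_of_real (t ^ k / fact k) * (\<Sum>z\<in>A. complex_of_real (fmpow A (Q 1) k x z) * chi q n w z)"
      by (simp add: sum_distrib_left mult.assoc)
    thus ?thesis unfolding sum_fmpow_chi[OF x]
      by (simp add: power_mult_distrib divide_inverse mult_ac)
  qed
  moreover have "(\<lambda>k. complex_of_real ((t * (Lam w - 1)) ^ k /\<^sub>R fact k) * chi q n w x) sums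
      (complex_of_real (exp (t * (Lam w - 1))) * chi q n w x)"
    by (intro sums_mult2 sums_of_real exp_converges)
  ultimately show ?thesis by (simp add: sums_unique2)
qed

lemma sum_Hker: "x \<in> A \<Longrightarrow> (\<Sum>z\<in>A. H t x z) = 1"
  using arg_cong[OF sum_Hker_chi[of x t "\<lambda>_. 0"], of Re] by (simp add: Lam_0)

lemma sum_Hker_cos: "(\<Sum>z\<in>A. H t (\<lambda>_. 0) z * Re (chi q n w z)) = exp (t * (Lam w - 1))"
  using arg_cong[OF sum_Hker_chi[OF zero_in_reps[OF q_pos], of t w], of Re] by simp

text \<open>Parseval: expand one factor \<open>H t x z\<close> in characters, and the sum over
  \<open>z\<close> of the other against a character returns the same exponential. Independence of
  \<open>x\<close> comes from characters having modulus 1.\<close>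

lemma sum_Hker_square:
  assumes x: "x \<in> A"
  shows "(\<Sum>z\<in>A. (H t x z)\<^sup>2) = (\<Sum>w\<in>A. exp (2 * t * (Lam w - 1))) / N"
proof -
  have 1: "(\<Sum>z\<in>A. H t x z * Re (chi q n w x * cnj (chi q n w z))) = exp (t * (Lam w - 1))" for w
  proof -
    have "(\<Sum>z\<in>A. H t x z * Re (chi q n w x * cnj (chi q n w z)))
        = Re (chi q n w x * cnj (\<Sum>z\<in>A. complex_of_real (H t x z) * chi q n w z))"
      by (simp add: sum_distrib_left sum_distrib_right sum.distrib sum_subtractf algebra_simps)
    also have "\<dots> = Re (complex_of_real (exp (t * (Lam w - 1))) * (chi q n w x * cnj (chi q n w x)))"
      unfolding sum_Hker_chi[OF x] by (simp only: complex_cnj_mult complex_cnj_complex_of_real mult_ac)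
    finally show ?thesis by (simp only: chi_mult_cnj mult_1_right Re_complex_of_real)
  qed
  have "(\<Sum>z\<in>A. (H t x z)\<^sup>2) = (\<Sum>z\<in>A. H t x z * ((\<Sum>w\<in>A. exp (t * (Lam w - 1)) * Re (chi q n w x * cnj (chi q n w z))) / N))"
    using x by (intro sum.cong refl) (simp only: Hker_eq[symmetric] power2_eq_square)
  also have "\<dots> = (\<Sum>w\<in>A. exp (t * (Lam w - 1)) * (\<Sum>z\<in>A. H t x z * Re (chi q n w x * cnj (chi q n w z)))) / N"
    by (simp only: times_divide_eq_right sum_divide_distrib[symmetric] sum_distrib_left)
       (subst sum.swap, simp only: mult.left_commute)
  also have "\<dots> = (\<Sum>w\<in>A. exp (2 * t * (Lam w - 1))) / N"
    unfolding 1 exp_add[symmetric] by (simp add: algebra_simps)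
  finally show ?thesis .
qed

text \<open>The deviations from uniform sum to 0, so a maximising set and its complement contribute
  equally and twice the distance is at most the l1 norm. Cauchy-Schwarz against the constant 1 then
  passes to the l2 norm, and squaring the factor 2 gives the 4.\<close>

lemma tv_unif_bound:
  fixes \<nu> :: "(nat \<Rightarrow> int) \<Rightarrow> real"
  assumes "(\<Sum>z\<in>A. \<nu> z) = 1"
  shows "0 \<le> tv_unif A \<nu>" "4 * (tv_unif A \<nu>)\<^sup>2 \<le> N * (\<Sum>z\<in>A. (\<nu> z)\<^sup>2) - 1"
proof -
  define D where "D z = \<nu> z - 1 / N" for z
  have D0: "(\<Sum>z\<in>A. D z) = 0" using assms N_pos by (simp add: D_def sum_subtractf)
  have DB: "(\<Sum>z\<in>B. \<nu> z) - real (card B) / N = (\<Sum>z\<in>B. D z)" if "B \<subseteq> A" for B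
    by (simp add: D_def sum_subtractf)
  have fin: "finite ((\<lambda>B. \<bar>(\<Sum>y\<in>B. \<nu> y) - real (card B) / N\<bar>) ` Pow A)"
    by (simp add: finite_reps)
  have "\<bar>(\<Sum>y\<in>{}. \<nu> y) - real (card ({} :: (nat \<Rightarrow> int) set)) / N\<bar> \<le> tv_unif A \<nu>"
    unfolding tv_unif_def by (intro Max_ge fin imageI) auto
  thus "0 \<le> tv_unif A \<nu>" by simp
  have "tv_unif A \<nu> \<in> (\<lambda>B. \<bar>(\<Sum>y\<in>B. \<nu> y) - real (card B) / N\<bar>) ` Pow A"
    unfolding tv_unif_def by (intro Max_in fin) auto
  then obtain B where B: "B \<subseteq> A" "tv_unif A \<nu> = \<bar>\<Sum>z\<in>B. D z\<bar>" using DB by auto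
  have split: "(\<Sum>z\<in>A. f z) = (\<Sum>z\<in>B. f z) + (\<Sum>z\<in>A - B. f z)" for f :: "(nat \<Rightarrow> int) \<Rightarrow> real"
    using sum.subset_diff[OF B(1) finite_reps, of f] by simp
  have "2 * tv_unif A \<nu> = \<bar>\<Sum>z\<in>B. D z\<bar> + \<bar>\<Sum>z\<in>A - B. D z\<bar>"
    using D0 unfolding split[of D] B(2) by linarith
  also have "\<dots> \<le> (\<Sum>z\<in>B. \<bar>D z\<bar>) + (\<Sum>z\<in>A - B. \<bar>D z\<bar>)"
    by (intro add_mono sum_abs)
  also have "\<dots> = (\<Sum>z\<in>A. \<bar>D z\<bar>)" by (rule split[symmetric])
  finally have le: "2 * tv_unif A \<nu> \<le> (\<Sum>z\<in>A. \<bar>D z\<bar>)" .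
  have "4 * (tv_unif A \<nu>)\<^sup>2 = (2 * tv_unif A \<nu>)\<^sup>2" by simp
  also have "\<dots> \<le> (\<Sum>z\<in>A. \<bar>D z\<bar>)\<^sup>2" using le \<open>0 \<le> tv_unif A \<nu>\<close> by (intro power_mono) auto
  also have "\<dots> = (\<Sum>z\<in>A. 1 * \<bar>D z\<bar>)\<^sup>2" by simp
  also have "\<dots> \<le> (\<Sum>z\<in>A. 1\<^sup>2) * (\<Sum>z\<in>A. \<bar>D z\<bar>\<^sup>2)" by (rule Cauchy_Schwarz_ineq_sum)
  also have "\<dots> = N * (\<Sum>z\<in>A. (\<nu> z)\<^sup>2 - 2 / N * \<nu> z + (1 / N)\<^sup>2)"
    by (simp add: D_def power2_diff algebra_simps)
  also have "\<dots> = N * (\<Sum>z\<in>A. (\<nu> z)\<^sup>2) - 1"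
    unfolding sum.distrib sum_subtractf sum_distrib_left[symmetric] assms using N_pos
    by (simp add: power2_eq_square field_simps)
  finally show "4 * (tv_unif A \<nu>)\<^sup>2 \<le> N * (\<Sum>z\<in>A. (\<nu> z)\<^sup>2) - 1" .
qed

lemma dwalk_bound:
  shows "0 \<le> dwalk q n mu t"
    and "4 * (dwalk q n mu t)\<^sup>2 \<le> (\<Sum>w\<in>A - {\<lambda>_. 0}. exp (2 * t * (Lam w - 1)))"
proof -
  have "dwalk q n mu t \<in> (\<lambda>x. tv_unif A (H t x)) ` A"
    unfolding dwalk_def using zero_in_reps[OF q_pos] by (intro Max_in) (auto simp: finite_reps)
  then obtain x where x: "x \<in> A" "dwalk q n mu t = tv_unif A (H t x)" by auto
  show "0 \<le> dwalk q n mu t" unfolding x(2) by (rule tv_unif_bound(1)[OF sum_Hker[OF x(1)]])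
  have "4 * (dwalk q n mu t)\<^sup>2 \<le> N * (\<Sum>z\<in>A. (H t x z)\<^sup>2) - 1"
    unfolding x(2) by (rule tv_unif_bound(2)[OF sum_Hker[OF x(1)]])
  also have "\<dots> = (\<Sum>w\<in>A. exp (2 * t * (Lam w - 1))) - 1"
    unfolding sum_Hker_square[OF x(1)] using N_pos by simp
  \<comment> \<open>The zero frequency has eigenvalue 1 and contributes exactly the 1 that is
    subtracted.\<close>
  also have "\<dots> = (\<Sum>w\<in>A - {\<lambda>_. 0}. exp (2 * t * (Lam w - 1)))"
    using sum.remove[OF finite_reps zero_in_reps[OF q_pos, of n], of "\<lambda>w. exp (2 * t * (Lam w - 1))"]
    by (simp add: Lam_0)
  finally show "4 * (dwalk q n mu t)\<^sup>2 \<le> (\<Sum>w\<in>A - {\<lambda>_. 0}. exp (2 * t * (Lam w - 1)))" .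
qed

lemma dwalk_tendsto_0: "((\<lambda>t. dwalk q n mu t) \<longlongrightarrow> 0) at_top"
proof -
  have "((\<lambda>t. exp (2 * t * (Lam w - 1))) \<longlongrightarrow> 0) at_top" if "w \<in> A - {\<lambda>_. 0}" for w
  proof -
    have "Lam w - 1 < 0" using Lam_lt_1 that by simp
    hence "filterlim (\<lambda>t. (2 * (Lam w - 1)) * t) at_bot at_top"
      by (intro filterlim_tendsto_neg_mult_at_bot[OF tendsto_const _ filterlim_ident]) simp
    from filterlim_compose[OF exp_at_bot this] show ?thesis by (simp add: mult_ac)
  qed
  hence "((\<lambda>t. \<Sum>w\<in>A - {\<lambda>_. 0}. exp (2 * t * (Lam w - 1))) \<longlongrightarrow> (\<Sum>w\<in>A - {\<lambda>_. 0}. 0)) at_top"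
    by (intro tendsto_sum)
  hence lim: "((\<lambda>t. \<Sum>w\<in>A - {\<lambda>_. 0}. exp (2 * t * (Lam w - 1))) \<longlongrightarrow> 0) at_top" by simp
  have "((\<lambda>t. 4 * (dwalk q n mu t)\<^sup>2) \<longlongrightarrow> 0) at_top"
    by (rule tendsto_sandwich[OF _ _ tendsto_const lim]) (auto intro!: always_eventually simp: dwalk_bound(2))
  from tendsto_real_sqrt[OF this] show ?thesis
    using tendsto_mult_left_iff[of 2 "dwalk q n mu" 0 at_top]
    by (simp add: real_sqrt_mult dwalk_bound(1))
qed

text \<open>A lower bound on an infimum of reals needs the set to be nonempty, since the infimum of
  the empty set carries no information; this is where convergence of the walk enters the lower
  bound.\<close>

lemma tmix_geI:
  assumes "\<And>t. 0 \<le> t \<Longrightarrow> t < T \<Longrightarrow> \<epsilon> < dwalk q n mu t" "0 < \<epsilon>"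
  shows "T \<le> tmix q n mu \<epsilon>"
  unfolding tmix_def
proof (rule cInf_greatest)
  have "eventually (\<lambda>t. dwalk q n mu t < \<epsilon>) at_top"
    using order_tendstoD(2)[OF dwalk_tendsto_0 assms(2)] .
  with eventually_ge_at_top[of 0] have "eventually (\<lambda>t. 0 \<le> t \<and> dwalk q n mu t \<le> \<epsilon>) at_top"
    by eventually_elim auto
  thus "{t. 0 \<le> t \<and> dwalk q n mu t \<le> \<epsilon>} \<noteq> {}"
    using eventually_happens[of _ "at_top :: real filter"] by fastforce
qed (use assms(1) in force)

text \<open>Second moment method: Cauchy--Schwarz against the measure \<open>\<nu> + 1 / N\<close>, with \<open>f\<close>
  centred at the midpoint of its two means.\<close>
lemma tv_unif_lower:
  fixes \<nu> f :: "(nat \<Rightarrow> int) \<Rightarrow> real"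
  assumes nu: "(\<Sum>z\<in>A. \<nu> z) = 1" "\<And>z. z \<in> A \<Longrightarrow> 0 \<le> \<nu> z" and f0: "(\<Sum>z\<in>A. f z) = 0"
  defines "m \<equiv> \<Sum>z\<in>A. \<nu> z * f z"
  shows "m\<^sup>2 \<le> (2 * ((\<Sum>z\<in>A. \<nu> z * (f z)\<^sup>2) - m\<^sup>2 + (\<Sum>z\<in>A. (f z)\<^sup>2) / N) + m\<^sup>2) * tv_unif A \<nu>"
proof -
  define D where "D z = \<nu> z - 1 / N" for z
  define E where "E z = \<nu> z + 1 / N" for z
  have Epos: "E z > 0" "\<bar>D z\<bar> \<le> E z" if "z \<in> A" for z
    using nu(2)[OF that] N_pos unfolding D_def E_def by (auto simp: add_nonneg_pos abs_le_iff)
  have D0: "(\<Sum>z\<in>A. D z) = 0" using nu N_pos by (simp add: D_def sum_subtractf)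
  have fin: "finite ((\<lambda>B. \<bar>(\<Sum>y\<in>B. \<nu> y) - real (card B) / N\<bar>) ` Pow A)"
    by (simp add: finite_reps)
  have tvD: "(\<Sum>z\<in>A. \<bar>D z\<bar>) \<le> 2 * tv_unif A \<nu>"
  proof -
    define B where "B = {z\<in>A. D z \<ge> 0}"
    have split: "(\<Sum>z\<in>A. f z) = (\<Sum>z\<in>B. f z) + (\<Sum>z\<in>A - B. f z)" for f :: "(nat \<Rightarrow> int) \<Rightarrow> real"
      using sum.subset_diff[of B A f] finite_reps by (simp add: B_def)
    have "(\<Sum>z\<in>A. \<bar>D z\<bar>) = (\<Sum>z\<in>B. D z) + (\<Sum>z\<in>A - B. - D z)"
      unfolding split by (intro arg_cong2[where f = "(+)"] sum.cong) (auto simp: B_def)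
    also have "\<dots> = 2 * (\<Sum>z\<in>B. D z)" using D0 unfolding split[of D] by (simp add: sum_negf)
    also have "(\<Sum>z\<in>B. D z) = (\<Sum>z\<in>B. \<nu> z) - real (card B) / N" by (simp add: D_def sum_subtractf)
    also have "\<dots> \<le> \<bar>(\<Sum>z\<in>B. \<nu> z) - real (card B) / N\<bar>" by simp
    also have "\<dots> \<le> tv_unif A \<nu>"
      unfolding tv_unif_def by (intro Max_ge fin imageI) (auto simp: B_def)
    finally show ?thesis by simp
  qed
  define h where "h z = f z - m / 2" for z
  have "h z * D z = \<nu> z * f z - 1 / N * f z - m / 2 * D z" for z
    by (simp add: h_def D_def algebra_simps)
  hence hD: "(\<Sum>z\<in>A. h z * D z) = m"
    by (simp only: sum_subtractf sum_distrib_left[symmetric] m_def[symmetric] f0 D0)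
  \<comment> \<open>The weight satisfies \<open>E z > 0\<close> because of the uniform part
    \<open>1 / N\<close>. From \<open>|D z| \<le> E z\<close> it follows that
    \<open>D z ^ 2 / E z \<le> |D z|\<close>, so the second Cauchy-Schwarz factor is at most twice
    the distance.\<close>
  have "m\<^sup>2 = (\<Sum>z\<in>A. (h z * sqrt (E z)) * (D z / sqrt (E z)))\<^sup>2"
    unfolding hD[symmetric]
    by (intro arg_cong[where f = "\<lambda>x. x\<^sup>2"] sum.cong refl) (use Epos(1) in \<open>simp add: less_imp_neq[symmetric]\<close>)
  also have "\<dots> \<le> (\<Sum>z\<in>A. (h z * sqrt (E z))\<^sup>2) * (\<Sum>z\<in>A. (D z / sqrt (E z))\<^sup>2)"
    by (rule Cauchy_Schwarz_ineq_sum)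
  also have "\<dots> \<le> (\<Sum>z\<in>A. (h z * sqrt (E z))\<^sup>2) * (2 * tv_unif A \<nu>)"
  proof (intro mult_left_mono sum_nonneg order.trans[OF sum_mono tvD])
    fix z assume z: "z \<in> A"
    have "(D z / sqrt (E z))\<^sup>2 = \<bar>D z\<bar> * \<bar>D z\<bar> / E z"
      using Epos(1)[OF z] by (simp add: power_divide power2_eq_square)
    also have "\<dots> \<le> \<bar>D z\<bar> * E z / E z"
      using Epos[OF z] by (intro divide_right_mono mult_left_mono) auto
    finally show "(D z / sqrt (E z))\<^sup>2 \<le> \<bar>D z\<bar>" using Epos(1)[OF z] by simp
  qed auto
  also have "(\<Sum>z\<in>A. (h z * sqrt (E z))\<^sup>2) = (\<Sum>z\<in>A. \<nu> z * (f z)\<^sup>2 - m * (\<nu> z * f z) + m\<^sup>2 / 4 * \<nu> z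
        + ((f z)\<^sup>2 / N - m / N * f z + m\<^sup>2 / 4 * (1 / N)))"
  proof (intro sum.cong refl)
    fix z assume z: "z \<in> A"
    have "(h z * sqrt (E z))\<^sup>2 = (h z)\<^sup>2 * E z" using Epos(1)[OF z] by (simp add: power_mult_distrib)
    thus "(h z * sqrt (E z))\<^sup>2 = \<nu> z * (f z)\<^sup>2 - m * (\<nu> z * f z) + m\<^sup>2 / 4 * \<nu> z
        + ((f z)\<^sup>2 / N - m / N * f z + m\<^sup>2 / 4 * (1 / N))"
      unfolding h_def E_def by (simp add: power2_eq_square field_simps)
  qed
  also have "\<dots> = (\<Sum>z\<in>A. \<nu> z * (f z)\<^sup>2) - m * m + m\<^sup>2 / 4 + ((\<Sum>z\<in>A. (f z)\<^sup>2) / N + m\<^sup>2 / 4)"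
    unfolding sum.distrib sum_subtractf sum_distrib_left[symmetric] m_def[symmetric] nu(1) f0
    using N_pos by (simp add: sum_divide_distrib)
  finally show ?thesis by (simp add: algebra_simps power2_eq_square)
qed

lemma tv_unif_le_dwalk: "tv_unif A (H t (\<lambda>_. 0)) \<le> dwalk q n mu t"
  unfolding dwalk_def using zero_in_reps[OF q_pos] by (intro Max_ge) (auto simp: finite_reps)

end

subsection \<open>Lattice sums of positive definite forms\<close>

text \<open>Extending the box to all integers only adds positive terms, and makes the sum periodic
  in \<open>s\<close>, so that the comparison with shift 0 becomes available.\<close>

lemma sum_int_box_le_theta:
  assumes "l > 0"
  shows "(\<Sum>m\<in>int_box q. exp (- l * (real_of_int m + s)\<^sup>2)) \<le> theta l 0"
proof -
  have "(\<Sum>m\<in>int_box q. exp (- l * (real_of_int m + s)\<^sup>2)) \<le> theta l s"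
    unfolding theta_def by (intro finite_sum_le_infsum gauss_summable assms finite_int_box) auto
  also have "\<dots> \<le> theta l 0" by (rule theta_le_theta_0[OF assms])
  finally show ?thesis .
qed

lemma sum_reps_squares_le:
  assumes L: "L > 0" and a: "\<And>k. k < n \<Longrightarrow> 0 < a k"
  shows "(\<Sum>y\<in>reps q n. exp (- L * (\<Sum>k<n. a k * (real_of_int (y k) - (\<Sum>i<k. c k i * real_of_int (y i)))\<^sup>2)))
           \<le> (\<Prod>k<n. theta (a k * L) 0)"
  using a
proof (induction n)
  case 0
  show ?case by (simp add: reps_0)
next
  case (Suc n)
  define R where "R y = (\<Sum>k<n. a k * (real_of_int (y k) - (\<Sum>i<k. c k i * real_of_int (y i)))\<^sup>2)" for y :: "nat \<Rightarrow> int"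
  define s where "s y = - (\<Sum>i<n. c n i * real_of_int (y i))" for y :: "nat \<Rightarrow> int"
  have l: "a n * L > 0" using Suc.prems[of n] L by simp
  \<comment> \<open>The linear forms are triangular, so the new coordinate \<open>m\<close> occurs
    only in the last square, with all earlier coordinates collected in the shift
    \<open>s y\<close>.\<close>
  have upd: "(\<Sum>k<Suc n. a k * (real_of_int ((y(n := m)) k) - (\<Sum>i<k. c k i * real_of_int ((y(n := m)) i)))\<^sup>2)
      = R y + a n * (real_of_int m + s y)\<^sup>2" for y m
  proof -
    have "(\<Sum>i<k. c k i * real_of_int ((y(n := m)) i)) = (\<Sum>i<k. c k i * real_of_int (y i))" if "k \<le> n" for k
      using that by (intro sum.cong) auto
    thus ?thesis by (simp add: R_def s_def)
  qed
  have "(\<Sum>y\<in>reps q (Suc n). exp (- L * (\<Sum>k<Suc n. a k * (real_of_int (y k) - (\<Sum>i<k. c k i * real_of_int (y i)))\<^sup>2)))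
      = (\<Sum>y\<in>reps q n. exp (- L * R y) * (\<Sum>m\<in>int_box q. exp (- (a n * L) * (real_of_int m + s y)\<^sup>2)))"
    unfolding sum_reps_Suc upd
    unfolding sum_distrib_left exp_add[symmetric]
    by (intro sum.cong refl arg_cong[where f = exp]) (simp add: algebra_simps)
  also have "\<dots> \<le> (\<Sum>y\<in>reps q n. exp (- L * R y) * theta (a n * L) 0)"
    by (intro sum_mono mult_left_mono sum_int_box_le_theta l) simp
  also have "\<dots> = (\<Sum>y\<in>reps q n. exp (- L * R y)) * theta (a n * L) 0"
    by (simp add: sum_distrib_right)
  also have "\<dots> \<le> (\<Prod>k<n. theta (a k * L) 0) * theta (a n * L) 0"
    unfolding R_def using Suc.prems by (intro mult_right_mono Suc.IH theta_nonneg) auto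
  finally show ?case by simp
qed

lemma prod_add_one_le_exp:
  fixes f :: "nat \<Rightarrow> real"
  assumes "\<And>k. k < n \<Longrightarrow> 0 \<le> h k" "\<And>k. k < n \<Longrightarrow> h k \<le> 1 + f k"
  shows "(\<Prod>k<n. h k) \<le> exp (\<Sum>k<n. f k)"
  unfolding exp_sum[OF finite_lessThan]
proof (rule prod_mono)
  fix k assume "k \<in> {..<n}"
  thus "0 \<le> h k \<and> h k \<le> exp (f k)"
    using assms(1) order.trans[OF assms(2) exp_ge_add_one_self] by simp
qed

lemma lattice_sum_le:
  assumes inv: "psd_inverse n G P" and x: "ln x \<ge> 2 / 3" "x > 0"
    and S: "\<And>k. k < n \<Longrightarrow> P k k \<le> S"
    and B: "(\<Sum>k = 1..n. x powr (- schur_a P k)) \<le> B"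
    and S0: "0 \<le> S"
  shows "(\<Sum>y\<in>reps q n. exp (- ln x * qform n G (\<lambda>i. real_of_int (y i)))) \<le> exp ((2 + S) * B)"
proof -
  interpret psd_inverse n G P by (rule inv)
  have x1: "x > 1" using ln_gt_zero_iff[OF x(2)] x(1) by linarith
  have "(\<Sum>y\<in>reps q n. exp (- ln x * qform n G (\<lambda>i. real_of_int (y i)))) \<le> (\<Prod>k<n. theta (schur_a P (Suc k) * ln x) 0)"
    unfolding qform_squares using x1 schur_a_pos(1) by (intro sum_reps_squares_le) auto
  also have "\<dots> \<le> exp (\<Sum>k<n. (2 + S) * exp (- (schur_a P (Suc k) * ln x)))"
  proof (rule prod_add_one_le_exp[OF theta_nonneg])
    fix k assume k: "k < n"
    \<comment> \<open>\<open>schur_a_pos\<close> and the bound on the diagonal give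
      \<open>1 / schur_a P (Suc k) \<le> P k k \<le> S\<close>.\<close>
    show "theta (schur_a P (Suc k) * ln x) 0 \<le> 1 + (2 + S) * exp (- (schur_a P (Suc k) * ln x))"
      using schur_a_pos[OF k] S[OF k] x(1) by (intro theta_0_le_linear) auto
  qed
  also have "(\<Sum>k<n. (2 + S) * exp (- (schur_a P (Suc k) * ln x))) = (2 + S) * (\<Sum>k = 1..n. x powr (- schur_a P k))"
    using x(2) by (simp add: sum_distrib_left[symmetric] powr_def sum.atLeast1_atMost_eq)
  also have "\<dots> \<le> (2 + S) * B" using B S0 by (intro mult_left_mono) auto
  finally show ?thesis by simp
qed

subsection \<open>Second moments of the increment\<close>

text \<open>The quotient of the coefficients \<open>1/24\<close> and \<open>1/2\<close> is the
  origin of the 12 in the correction factor of the upper bound.\<close>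

lemma cos_le_quartic: "cos (x :: real) \<le> 1 - x\<^sup>2 / 2 + x ^ 4 / 24"
proof -
  obtain t where t: "cos x = (\<Sum>m<4. cos_coeff m * x ^ m) + (cos (t + 1 / 2 * real 4 * pi) / fact 4) * x ^ 4"
    using Maclaurin_cos_expansion[of x 4] by blast
  have "{..<4} = ({0, 1, 2, 3} :: nat set)" by auto
  hence "(\<Sum>m<4. cos_coeff m * x ^ m) = 1 - x\<^sup>2 / 2" by (simp add: cos_coeff_def)
  moreover have "(cos (t + 1 / 2 * real 4 * pi) / fact 4) * x ^ 4 \<le> (1 / 24) * x ^ 4"
    by (intro mult_right_mono) (simp_all add: fact_numeral)
  ultimately show ?thesis using t by simp
qed

lemma cos_ge_quadratic: "1 - x\<^sup>2 / 2 \<le> cos (x :: real)"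
proof -
  obtain t where t: "cos x = (\<Sum>m<2. cos_coeff m * x ^ m) + (cos (t + 1 / 2 * real 2 * pi) / fact 2) * x ^ 2"
    using Maclaurin_cos_expansion[of x 2] by blast
  have "{..<2} = ({0, 1} :: nat set)" by auto
  hence "(\<Sum>m<2. cos_coeff m * x ^ m) = 1" by (simp add: cos_coeff_def)
  moreover have "(- 1 / 2) * x ^ 2 \<le> (cos (t + 1 / 2 * real 2 * pi) / fact 2) * x ^ 2"
    by (intro mult_right_mono) simp_all
  ultimately show ?thesis using t by simp
qed

lemma abs_sin_minus_self_le: "\<bar>sin x - x\<bar> \<le> \<bar>x :: real\<bar> ^ 3 / 6"
proof -
  obtain t where t: "sin x = (\<Sum>m<3. sin_coeff m * x ^ m) + (sin (t + 1 / 2 * real 3 * pi) / fact 3) * x ^ 3"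
    using Maclaurin_sin_expansion[of x 3] by blast
  have "{..<3} = ({0, 1, 2} :: nat set)" by auto
  hence "(\<Sum>m<3. sin_coeff m * x ^ m) = x" by (simp add: sin_coeff_def)
  hence "\<bar>sin x - x\<bar> = \<bar>sin (t + 1 / 2 * real 3 * pi)\<bar> / 6 * \<bar>x\<bar> ^ 3"
    using t by (simp add: abs_mult power_abs fact_numeral)
  also have "\<dots> \<le> 1 / 6 * \<bar>x\<bar> ^ 3"
    by (intro mult_right_mono divide_right_mono) simp_all
  finally show ?thesis by simp
qed

locale torus_walk_moments = torus_walk +
  fixes r s2 :: real
  assumes n_pos: "n \<ge> 1" and s2_pos: "s2 > 0" and r_pos: "r > 0"
    and l1: "\<And>y. y \<in> reps q n \<Longrightarrow> mu y > 0 \<Longrightarrow> (\<Sum>i<n. real_of_int \<bar>y i\<bar>) \<le> r"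
    and linf: "\<And>y i. y \<in> reps q n \<Longrightarrow> mu y > 0 \<Longrightarrow> i < n \<Longrightarrow> real_of_int \<bar>y i\<bar> < real q / 2"
    and var: "\<And>k. k < n \<Longrightarrow> Var_mu q n mu k = s2 / real n"
begin

abbreviation "E \<equiv> Ex_mu q n mu"
abbreviation "Corr \<equiv> Corr_mu q n mu"

lemma E_mono:
  assumes "\<And>y. y \<in> A \<Longrightarrow> mu y > 0 \<Longrightarrow> f y \<le> g y"
  shows "E f \<le> E g"
  unfolding Ex_mu_def
proof (rule sum_mono)
  fix y assume "y \<in> A"
  thus "mu y * f y \<le> mu y * g y"
    using assms[of y] mu_nonneg[of y] by (cases "mu y = 0") (auto intro!: mult_left_mono)
qed

lemma E_add: "E (\<lambda>y. f y + g y) = E f + E g"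
  by (simp add: Ex_mu_def distrib_left sum.distrib)

lemma E_diff: "E (\<lambda>y. f y - g y) = E f - E g"
  by (simp add: Ex_mu_def right_diff_distrib sum_subtractf)

lemma E_cmult: "E (\<lambda>y. c * f y) = c * E f"
  by (simp add: Ex_mu_def sum_distrib_left mult.left_commute)

lemma E_const: "E (\<lambda>y. c) = c"
  by (simp add: Ex_mu_def sum_distrib_right[symmetric] mu_sum)

lemma E_sum: "E (\<lambda>y. \<Sum>i\<in>I. f i y) = (\<Sum>i\<in>I. E (f i))"
  unfolding Ex_mu_def sum_distrib_left by (rule sum.swap)

text \<open>For even \<open>q\<close> the representative \<open>- q / 2\<close> is its own negative
  modulo \<open>q\<close>, so symmetry of \<open>mu\<close> alone need not give mean 0. The strict
  bound \<open>linf\<close> keeps that value out of the support, and there \<open>negq\<close> is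
  honest negation.\<close>

lemma mean_0:
  assumes k: "k < n"
  shows "E (\<lambda>y. real_of_int (y k)) = 0"
proof -
  have "E (\<lambda>y. real_of_int (y k)) = (\<Sum>y\<in>A. mu (negq q n y) * real_of_int (negq q n y k))"
    unfolding Ex_mu_def by (rule sum.reindex_bij_betw[OF bij_negq[OF q_pos], symmetric])
  also have "\<dots> = (\<Sum>y\<in>A. - (mu y * real_of_int (y k)))"
  proof (intro sum.cong refl)
    fix y assume y: "y \<in> A"
    show "mu (negq q n y) * real_of_int (negq q n y k) = - (mu y * real_of_int (y k))"
    proof (cases "mu y > 0")
      case True
      have "real_of_int \<bar>y k\<bar> < real q / 2" by (rule linf[OF y True k])
      hence "real_of_int (2 * \<bar>y k\<bar>) < real_of_int (int q)" by simp
      hence "2 * \<bar>y k\<bar> < int q" by (simp only: of_int_less_iff)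
      hence "redq q (- y k) = - y k"
        by (intro reps_residue_unique[of q] redq_bounds[OF q_pos] redq_dvd) linarith+
      thus ?thesis using k by (simp add: negq_def mu_neg[OF y, unfolded negq_def])
    next
      case False
      hence "mu y = 0" using mu_nonneg[of y] by simp
      thus ?thesis using mu_neg[OF y] by simp
    qed
  qed
  also have "\<dots> = - E (\<lambda>y. real_of_int (y k))" by (simp add: Ex_mu_def sum_negf)
  finally show ?thesis by simp
qed

lemma Cov_eq:
  assumes "k < n" "l < n"
  shows "Cov_mu q n mu k l = E (\<lambda>y. real_of_int (y k) * real_of_int (y l))"
  unfolding Cov_mu_def mean_0[OF assms(1)] mean_0[OF assms(2)] by simp

lemma E_product:
  assumes "k < n" "l < n"
  shows "E (\<lambda>y. real_of_int (y k) * real_of_int (y l)) = s2 / real n * Corr k l"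
proof -
  have "sqrt (s2 / real n * (s2 / real n)) = s2 / real n"
    using s2_pos by (simp only: real_sqrt_abs2) simp
  thus ?thesis using assms s2_pos n_pos
    by (simp add: Corr_mu_def var Cov_eq)
qed

lemma E_square:
  assumes "k < n" shows "E (\<lambda>y. (real_of_int (y k))\<^sup>2) = s2 / real n"
  using var[OF assms] Cov_eq[OF assms assms] by (simp add: Var_mu_def power2_eq_square)

lemma E_linear_square:
  "E (\<lambda>y. (\<Sum>i<n. \<theta> i * real_of_int (y i))\<^sup>2) = s2 / real n * qform n Corr \<theta>"
proof -
  have "(\<lambda>y :: nat \<Rightarrow> int. (\<Sum>i<n. \<theta> i * real_of_int (y i))\<^sup>2)
      = (\<lambda>y. \<Sum>i<n. \<Sum>j<n. (\<theta> i * \<theta> j) * (real_of_int (y i) * real_of_int (y j)))"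
    by (simp add: power2_eq_square sum_product mult_ac)
  hence "E (\<lambda>y. (\<Sum>i<n. \<theta> i * real_of_int (y i))\<^sup>2)
      = (\<Sum>i<n. \<Sum>j<n. (\<theta> i * \<theta> j) * E (\<lambda>y. real_of_int (y i) * real_of_int (y j)))"
    by (simp add: E_sum E_cmult)
  also have "\<dots> = (\<Sum>i<n. \<Sum>j<n. s2 / real n * (\<theta> i * Corr i j * \<theta> j))"
    by (intro sum.cong refl) (simp add: E_product)
  finally show ?thesis by (simp add: qform_def sum_distrib_left)
qed

lemma Corr_psd: "0 \<le> qform n Corr y"
proof -
  have "0 \<le> E (\<lambda>z. (\<Sum>i<n. y i * real_of_int (z i))\<^sup>2)"
    unfolding Ex_mu_def by (intro sum_nonneg mult_nonneg_nonneg mu_nonneg) auto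
  moreover have "0 < s2 / real n" using s2_pos n_pos by simp
  ultimately show ?thesis unfolding E_linear_square by (metis mult_pos_neg not_le)
qed

lemma Corr_sym: "Corr i j = Corr j i"
  by (simp add: Corr_mu_def Cov_mu_def mult.commute)

lemma Corr_psd_inverse:
  assumes "invertible_n n Corr"
  shows "psd_inverse n Corr (minv n Corr)"
  using assms by unfold_locales
    (auto simp: invertible_n_def intro: is_inverse_minv(1) Corr_sym Corr_psd)

lemma Lam_E: "Lam w = E (\<lambda>y. cos (\<Sum>i<n. 2 * pi * real_of_int (w i) / real q * real_of_int (y i)))"
  unfolding Lam_eq Ex_mu_def cis_chi[symmetric] by simp

text \<open>The inner product \<open>u y\<close> is at most the sup norm of the frequency times the
  l1 norm of the increment, so \<open>u y ^ 2 \<le> r ^ 2 / q\<close>. Hence the quartic term of the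
  cosine is absorbed into the quadratic one at the cost of the factor
  \<open>1 - r ^ 2 / (12 q)\<close>, and the second moment finishes.\<close>

lemma Lam_upper:
  assumes w: "\<And>i. i < n \<Longrightarrow> \<bar>2 * pi * real_of_int (w i) / real q\<bar> \<le> 1 / sqrt (real q)"
  shows "Lam w - 1 \<le> - (2 * pi\<^sup>2 * s2 / (real n * (real q)\<^sup>2) * (1 - r\<^sup>2 / (12 * real q))
            * qform n Corr (\<lambda>i. real_of_int (w i)))"
proof -
  define \<theta> where "\<theta> i = 2 * pi * real_of_int (w i) / real q" for i
  define u where "u y = (\<Sum>i<n. \<theta> i * real_of_int (y i))" for y :: "nat \<Rightarrow> int"
  define c where "c = 1 - r\<^sup>2 / (12 * real q)"
  define K where "K = c / 2"
  have "Lam w = E (\<lambda>y. cos (u y))" unfolding Lam_E u_def \<theta>_def ..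
  also have "\<dots> \<le> E (\<lambda>y. 1 - K * (u y)\<^sup>2)"
  proof (rule E_mono)
    fix y assume y: "y \<in> A" "mu y > 0"
    have "\<bar>u y\<bar> \<le> (\<Sum>i<n. \<bar>\<theta> i * real_of_int (y i)\<bar>)" unfolding u_def by (rule sum_abs)
    also have "\<dots> \<le> (\<Sum>i<n. 1 / sqrt (real q) * real_of_int \<bar>y i\<bar>)"
      unfolding abs_mult of_int_abs using w by (intro sum_mono mult_right_mono) (auto simp: \<theta>_def)
    also have "\<dots> = 1 / sqrt (real q) * (\<Sum>i<n. real_of_int \<bar>y i\<bar>)" by (simp only: sum_distrib_left)
    also have "\<dots> \<le> 1 / sqrt (real q) * r" by (intro mult_left_mono l1 y) simp
    finally have "\<bar>u y\<bar>\<^sup>2 \<le> (1 / sqrt (real q) * r)\<^sup>2" by (intro power_mono) auto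
    hence u2: "(u y)\<^sup>2 \<le> r\<^sup>2 / real q" by (simp add: power_mult_distrib power_divide)
    have "cos (u y) \<le> 1 - (u y)\<^sup>2 / 2 + (u y)\<^sup>2 * (u y)\<^sup>2 / 24"
      using cos_le_quartic[of "u y"] by (simp add: power2_eq_square power4_eq_xxxx mult.assoc)
    also have "\<dots> \<le> 1 - (u y)\<^sup>2 / 2 + (u y)\<^sup>2 * (r\<^sup>2 / real q) / 24"
      by (intro add_left_mono divide_right_mono mult_left_mono u2) auto
    also have "\<dots> = 1 - K * (u y)\<^sup>2"
    proof -
      define R where "R = r\<^sup>2 / real q"
      have c: "c = 1 - R / 12" by (simp add: c_def R_def)
      show ?thesis unfolding K_def c R_def[symmetric] by (simp add: field_simps)
    qed
    finally show "cos (u y) \<le> 1 - K * (u y)\<^sup>2" .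
  qed
  also have "\<dots> = 1 - K * (s2 / real n * qform n Corr \<theta>)"
    unfolding E_diff E_cmult E_const u_def E_linear_square ..
  also have "qform n Corr \<theta> = (2 * pi / real q)\<^sup>2 * qform n Corr (\<lambda>i. real_of_int (w i))"
    by (simp add: qform_def \<theta>_def sum_distrib_left power2_eq_square mult_ac)
  finally show ?thesis unfolding K_def c_def[symmetric] by (simp add: power2_eq_square mult_ac)
qed

lemma dwalk_upper:
  assumes inv: "invertible_n n Corr" and x: "ln x \<ge> 2 / 3" "x > 0"
    and S: "\<And>k. k < n \<Longrightarrow> minv n Corr k k \<le> S" "0 \<le> S"
    and B: "(\<Sum>k = 1..n. x powr (- schur_a (minv n Corr) k)) \<le> B"
    and pos: "1 - r\<^sup>2 / (12 * real q) > 0"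
  defines "t \<equiv> real n * (real q)\<^sup>2 * ln x / (4 * pi\<^sup>2 * s2) * inverse (1 - r\<^sup>2 / (12 * real q))"
  shows "4 * (dwalk q n mu t)\<^sup>2 \<le> (\<Sum>y\<in>Lset q n. exp (2 * t * (Lam y - 1))) + (exp ((2 + S) * B) - 1)"
proof -
  define F where "F y = exp (2 * t * (Lam y - 1))" for y
  define g where "g y = exp (- ln x * qform n Corr (\<lambda>i. real_of_int (y i)))" for y :: "nat \<Rightarrow> int"
  have "0 \<le> ln x" using x by linarith
  moreover have "0 \<le> inverse (1 - r\<^sup>2 / (12 * real q))"
    by (rule less_imp_le[OF positive_imp_inverse_positive[OF pos]])
  ultimately have t0: "t \<ge> 0"
    unfolding t_def using s2_pos by (intro mult_nonneg_nonneg divide_nonneg_nonneg) auto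
  have L: "Lset q n \<subseteq> A - {\<lambda>_. 0}" by (auto simp: Lset_def)
  have Fg: "F w \<le> g w" if "w \<in> A - {\<lambda>_. 0} - Lset q n" for w
  proof -
    have "\<bar>2 * pi * real_of_int (w i) / real q\<bar> \<le> 1 / sqrt (real q)" if "i < n" for i
    proof (rule ccontr)
      assume "\<not> ?thesis"
      hence "w \<in> Lset q n" using \<open>w \<in> A - {\<lambda>_. 0} - Lset q n\<close> that unfolding Lset_def not_le by blast
      thus False using \<open>w \<in> A - {\<lambda>_. 0} - Lset q n\<close> by simp
    qed
    from mult_left_mono[OF Lam_upper[OF this], where c = "2 * t"] t0
    have "2 * t * (Lam w - 1) \<le> - (2 * t * (2 * pi\<^sup>2 * s2 / (real n * (real q)\<^sup>2) * (1 - r\<^sup>2 / (12 * real q)))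
            * qform n Corr (\<lambda>i. real_of_int (w i)))" by (simp add: mult_ac)
    \<comment> \<open>The time \<open>t\<close> is chosen for this cancellation: its inverse factor
      removes the loss from the quartic term.\<close>
    also have "2 * t * (2 * pi\<^sup>2 * s2 / (real n * (real q)\<^sup>2) * (1 - r\<^sup>2 / (12 * real q))) = ln x"
    proof -
      define K where "K = 1 - r\<^sup>2 / (12 * real q)"
      have "K > 0" using pos by (simp only: K_def)
      thus ?thesis unfolding t_def K_def[symmetric] using n_pos q_pos s2_pos
        by (simp add: field_simps)
    qed
    finally show ?thesis unfolding F_def g_def by simp
  qed
  have "4 * (dwalk q n mu t)\<^sup>2 \<le> (\<Sum>w\<in>A - {\<lambda>_. 0}. F w)" unfolding F_def by (rule dwalk_bound(2))
  also have "\<dots> = (\<Sum>w\<in>A - {\<lambda>_. 0} - Lset q n. F w) + (\<Sum>w\<in>Lset q n. F w)"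
    by (rule sum.subset_diff[OF L]) (simp add: finite_reps)
  also have "(\<Sum>w\<in>A - {\<lambda>_. 0} - Lset q n. F w) \<le> (\<Sum>w\<in>A - {\<lambda>_. 0} - Lset q n. g w)"
    by (intro sum_mono Fg)
  also have "\<dots> \<le> (\<Sum>w\<in>A - {\<lambda>_. 0}. g w)"
    by (intro sum_mono2) (auto simp: finite_reps g_def)
  \<comment> \<open>Frequencies in \<open>Lset\<close> have been put back with their positive values
    of \<open>g\<close>; the zero frequency has \<open>g = 1\<close>.\<close>
  also have "\<dots> = (\<Sum>w\<in>A. g w) - 1"
    using sum.remove[OF finite_reps zero_in_reps[OF q_pos, of n], of g] by (simp add: g_def qform_def)
  also have "(\<Sum>w\<in>A. g w) \<le> exp ((2 + S) * B)"
    unfolding g_def by (rule lattice_sum_le[OF Corr_psd_inverse[OF inv] x S(1) B S(2)])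
  finally show ?thesis unfolding F_def by simp
qed

end

subsection \<open>The upper bound\<close>

lemma tendsto_sum_powr_at_right:
  fixes a :: "'a \<Rightarrow> real"
  assumes "0 < z * c"
  shows "((\<lambda>z. \<Sum>k\<in>I. (z * c) powr a k) \<longlongrightarrow> (\<Sum>k\<in>I. (z * c) powr a k)) (at_right z)"
  by (intro tendsto_intros) (use assms in auto)

lemma max_norm_ge:
  assumes "i < n" "j < n"
  shows "\<bar>M i j\<bar> \<le> max_norm n M"
  unfolding max_norm_def
proof (rule Max_ge)
  have "{\<bar>M i j\<bar> |i j. i < n \<and> j < n} = (\<lambda>(i, j). \<bar>M i j\<bar>) ` ({..<n} \<times> {..<n})" by auto
  thus "finite ({\<bar>M i j\<bar> |i j. i < n \<and> j < n} \<union> {0})" by simp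
qed (use assms in blast)

lemma max_norm_nonneg: "0 \<le> max_norm n M"
proof -
  have "{\<bar>M i j\<bar> |i j. i < n \<and> j < n} = (\<lambda>(i, j). \<bar>M i j\<bar>) ` ({..<n} \<times> {..<n})" by auto
  hence "finite ({\<bar>M i j\<bar> |i j. i < n \<and> j < n} \<union> {0})" by simp
  thus ?thesis unfolding max_norm_def by (rule Max_ge) simp
qed

text \<open>The infimum defining \<open>\<alpha>\<close> need not be attained, since \<open>g\<close> may be discontinuous; for each
  fixed \<open>n\<close> the sum itself is continuous, so its bound extends from \<open>z > \<alpha>\<close> to \<open>\<alpha>\<close>.\<close>
lemma correlation_sum_at_Inf:
  fixes S \<epsilon> :: real
  assumes cc: "correlation_condition P g" and S: "0 \<le> S" and \<epsilon>: "0 < \<epsilon>"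
  defines "\<alpha> \<equiv> Inf {z. 1 \<le> z \<and> 4 * \<epsilon>\<^sup>2 \<ge> exp ((2 + S) * g z) - 1}"
  shows "1 \<le> \<alpha>"
    and "n \<ge> 1 \<Longrightarrow> (\<Sum>k = 1..n. (\<alpha> * real n) powr (- schur_a (P n) k)) \<le> ln (1 + 4 * \<epsilon>\<^sup>2) / (2 + S)"
proof -
  define Z where "Z = {z. 1 \<le> z \<and> 4 * \<epsilon>\<^sup>2 \<ge> exp ((2 + S) * g z) - 1}"
  have \<alpha>: "\<alpha> = Inf Z" by (simp add: \<alpha>_def Z_def)
  have g_mono: "g b \<le> g a" if "1 \<le> a" "a \<le> b" for a b
    using cc that by (auto simp: correlation_condition_def)
  have pos: "1 + 4 * \<epsilon>\<^sup>2 > 0" by (simp add: add_pos_nonneg)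
  \<comment> \<open>Since \<open>g\<close> tends to 0 and \<epsilon> is positive, large
    \<open>z\<close> satisfy the defining inequality; thus the infimum is over a nonempty
    set.\<close>
  have "((\<lambda>z. exp ((2 + S) * g z) - 1) \<longlongrightarrow> exp ((2 + S) * 0) - 1) at_top"
    using cc by (intro tendsto_intros) (auto simp: correlation_condition_def)
  hence "eventually (\<lambda>z. exp ((2 + S) * g z) - 1 < 4 * \<epsilon>\<^sup>2) at_top"
    using \<epsilon> by (intro order_tendstoD(2)) auto
  with eventually_ge_at_top[of 1] have "eventually (\<lambda>z. z \<in> Z) at_top"
    by eventually_elim (auto simp: Z_def)
  then obtain z0 where "z0 \<in> Z" using eventually_happens[of _ "at_top :: real filter"] by auto
  hence ne: "Z \<noteq> {}" by auto
  show \<alpha>1: "1 \<le> \<alpha>" unfolding \<alpha> using ne by (intro cInf_greatest) (auto simp: Z_def)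
  assume n: "n \<ge> 1"
  have bound: "(\<Sum>k = 1..n. (z * real n) powr (- schur_a (P n) k)) \<le> ln (1 + 4 * \<epsilon>\<^sup>2) / (2 + S)"
    if z: "\<alpha> < z" for z
  proof -
    obtain z' where z': "z' \<in> Z" "z' < z" using cInf_lessD[OF ne] z unfolding \<alpha> by blast
    have "exp ((2 + S) * g z') \<le> 1 + 4 * \<epsilon>\<^sup>2" using z'(1) by (simp add: Z_def)
    hence "(2 + S) * g z' \<le> ln (1 + 4 * \<epsilon>\<^sup>2)" using pos by (simp add: ln_ge_iff)
    hence "g z' \<le> ln (1 + 4 * \<epsilon>\<^sup>2) / (2 + S)" using S by (simp add: field_simps)
    moreover have "(\<Sum>k = 1..n. (z * real n) powr (- schur_a (P n) k)) \<le> g z"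
      using cc n z \<alpha>1 by (auto simp: correlation_condition_def)
    moreover have "g z \<le> g z'" using z' by (intro g_mono) (auto simp: Z_def)
    ultimately show ?thesis by linarith
  qed
  show "(\<Sum>k = 1..n. (\<alpha> * real n) powr (- schur_a (P n) k)) \<le> ln (1 + 4 * \<epsilon>\<^sup>2) / (2 + S)"
  proof (rule tendsto_upperbound)
    show "((\<lambda>z. \<Sum>k = 1..n. (z * real n) powr (- schur_a (P n) k)) \<longlongrightarrow>
        (\<Sum>k = 1..n. (\<alpha> * real n) powr (- schur_a (P n) k))) (at_right \<alpha>)"
      using n \<alpha>1 by (intro tendsto_sum_powr_at_right) auto
    show "\<forall>\<^sub>F z in at_right \<alpha>. (\<Sum>k = 1..n. (z * real n) powr (- schur_a (P n) k)) \<le> ln (1 + 4 * \<epsilon>\<^sup>2) / (2 + S)"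
      using bound by (auto simp: eventually_at_filter)
  qed simp
qed

lemma mixing_upper:
  fixes q :: "nat \<Rightarrow> nat" and r sig2 :: "nat \<Rightarrow> real" and mu :: "nat \<Rightarrow> (nat \<Rightarrow> int) \<Rightarrow> real"
  assumes walk: "\<And>n. n \<ge> 1 \<Longrightarrow> torus_walk_moments (q n) n (mu n) (r n) (sig2 n)"
    and eps: "0 < \<epsilon>"
    and decay: "decay_condition q sig2 mu"
    and inv: "\<And>n. n \<ge> 1 \<Longrightarrow> invertible_n n (Corr_mu (q n) n (mu n))"
    and cc: "correlation_condition (\<lambda>n. minv n (Corr_mu (q n) n (mu n))) g"
    and rq: "(\<lambda>n. (r n)\<^sup>2 / real (q n)) \<longlonglongrightarrow> 0"
  defines "S \<equiv> SUP n\<in>{1..}. max_norm n (minv n (Corr_mu (q n) n (mu n)))"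
  defines "\<alpha> \<equiv> Inf {z. 1 \<le> z \<and> 4 * \<epsilon>\<^sup>2 \<ge> exp ((2 + S) * g z) - 1}"
  defines "t \<equiv> \<lambda>n. real n * (real (q n))\<^sup>2 * ln (\<alpha> * real n) / (4 * pi\<^sup>2 * sig2 n)
                      * inverse (1 - (r n)\<^sup>2 / (12 * real (q n)))"
  shows "\<exists>e. e \<longlonglongrightarrow> 0 \<and> (\<forall>\<^sub>F n in sequentially. dwalk (q n) n (mu n) (t n) \<le> \<epsilon> + e n)"
proof -
  define P where "P = (\<lambda>n. minv n (Corr_mu (q n) n (mu n)))"
  have bdd: "bdd_above ((\<lambda>n. max_norm n (P n)) ` {1..})"
    using cc by (simp add: correlation_condition_def P_def)
  have PS: "max_norm n (P n) \<le> S" if "n \<ge> 1" for n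
    unfolding S_def P_def using that bdd[unfolded P_def] by (intro cSUP_upper) auto
  have S0: "0 \<le> S" using max_norm_nonneg[of 1 "P 1"] PS[of 1] by linarith
  note \<alpha>1 = correlation_sum_at_Inf(1)[OF cc S0 eps, folded \<alpha>_def]
  note \<alpha>_sum = correlation_sum_at_Inf(2)[OF cc S0 eps, folded \<alpha>_def]
  \<comment> \<open>The Decay Condition speaks of sequences above the threshold for every
    \<open>n\<close>, while \<open>t n\<close> may be negative or meaningless as long as the
    correction factor is not positive. \<open>t'\<close> falls back to the threshold there and
    agrees with \<open>t\<close> eventually; at \<open>n = 0\<close> both are 0.\<close>
  define good where "good n \<longleftrightarrow> 0 < 1 - (r n)\<^sup>2 / (12 * real (q n))" for n
  define t' where "t' n = (if good n then t n else
      real n * real (q n)^2 * ln (real n) / (4 * pi^2 * sig2 n))" for n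
  have sig: "sig2 n > 0" if "n \<ge> 1" for n
    using walk[OF that] by (simp add: torus_walk_moments_def torus_walk_moments_axioms_def)
  have t'_ge: "t' n \<ge> real n * real (q n)^2 * ln (real n) / (4 * pi^2 * sig2 n)" for n
  proof (cases "good n \<and> n \<ge> 1")
    case True
    hence n: "n \<ge> 1" and pos: "0 < 1 - (r n)\<^sup>2 / (12 * real (q n))" by (auto simp: good_def)
    have "ln (real n) \<le> ln (\<alpha> * real n)" using n \<alpha>1 by (subst ln_le_cancel_iff) auto
    hence 1: "real n * real (q n)^2 * ln (real n) / (4 * pi^2 * sig2 n) \<le>
        real n * real (q n)^2 * ln (\<alpha> * real n) / (4 * pi^2 * sig2 n)"
      using sig[OF n] by (intro divide_right_mono mult_left_mono) auto
    have 2: "1 \<le> inverse (1 - (r n)\<^sup>2 / (12 * real (q n)))"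
      using pos by (intro one_le_inverse) auto
    have "0 \<le> real n * real (q n)^2 * ln (real n) / (4 * pi^2 * sig2 n)"
      using n sig[OF n] by simp
    hence "real n * real (q n)^2 * ln (\<alpha> * real n) / (4 * pi^2 * sig2 n) * 1 \<le> t n"
      unfolding t_def using 1 by (intro mult_left_mono 2) linarith
    thus ?thesis using 1 True by (simp add: t'_def)
  next
    case False
    thus ?thesis by (cases "n = 0") (auto simp: t'_def t_def)
  qed
  define Ls where "Ls n = (\<Sum>y\<in>Lset (q n) n.
      exp (2 * t' n * (Phi_mu (q n) n (mu n) (\<lambda>i. 2 * pi * real_of_int (y i) / real (q n)) - 1)))" for n
  have Ls0: "Ls \<longlonglongrightarrow> 0"
    using decay t'_ge unfolding decay_condition_def Ls_def by blast
  \<comment> \<open>Exactly the excess over \<epsilon> left by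
    \<open>4 d ^ 2 \<le> Ls n + 4 \<epsilon> ^ 2\<close>, where \<open>d\<close> is the distance at
    time \<open>t n\<close>.\<close>
  define e where "e n = sqrt (\<epsilon>\<^sup>2 + Ls n / 4) - \<epsilon>" for n
  have "e \<longlonglongrightarrow> sqrt (\<epsilon>\<^sup>2 + 0 / 4) - \<epsilon>" unfolding e_def by (intro tendsto_intros Ls0) simp
  hence e0: "e \<longlonglongrightarrow> 0" using eps by simp
  have ev1: "\<forall>\<^sub>F n in sequentially. good n"
  proof -
    have "(\<lambda>n. 1 - (r n)\<^sup>2 / real (q n) / 12) \<longlonglongrightarrow> 1 - 0 / 12" by (intro tendsto_intros rq) simp
    hence "\<forall>\<^sub>F n in sequentially. 0 < 1 - (r n)\<^sup>2 / real (q n) / 12"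
      by (intro order_tendstoD(1)) auto
    thus ?thesis by (simp only: good_def divide_divide_eq_left mult.commute[of 12])
  qed
  have ev2: "\<forall>\<^sub>F n in sequentially. 3 \<le> real n"
    using filterlim_at_top[THEN iffD1, OF filterlim_real_sequentially] by blast
  have "\<forall>\<^sub>F n in sequentially. dwalk (q n) n (mu n) (t n) \<le> \<epsilon> + e n"
    using ev1 ev2
  proof eventually_elim
    case (elim n)
    hence n: "n \<ge> 1" by simp
    interpret torus_walk_moments "q n" n "mu n" "r n" "sig2 n" by (rule walk[OF n])
    \<comment> \<open>\<open>n \<ge> 3\<close> makes \<open>\<alpha> n\<close> at least Euler's
      number, so its logarithm exceeds the threshold \<open>2/3\<close> of the theta
      estimate.\<close>
    have "exp 1 \<le> (3 :: real)" by (rule exp_le)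
    also have "\<dots> \<le> \<alpha> * real n" using elim(2) \<alpha>1 mult_mono[of 1 \<alpha> 3 "real n"] by simp
    finally have "1 \<le> ln (\<alpha> * real n)" using \<alpha>1 n by (subst ln_ge_iff) auto
    hence x: "2 / 3 \<le> ln (\<alpha> * real n)" "0 < \<alpha> * real n" using \<alpha>1 n by auto
    have "minv n (Corr_mu (q n) n (mu n)) k k \<le> S" if "k < n" for k
      using max_norm_ge[OF that that, of "P n"] PS[OF n] by (simp add: P_def)
    from dwalk_upper[OF inv[OF n] x this S0 \<alpha>_sum[OF n] elim(1)[unfolded good_def]]
    have "4 * (dwalk (q n) n (mu n) (t n))\<^sup>2 \<le> Ls n + (exp ((2 + S) * (ln (1 + 4 * \<epsilon>\<^sup>2) / (2 + S))) - 1)"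
      using elim(1) by (simp add: t_def Ls_def t'_def Lam_def)
    also have "exp ((2 + S) * (ln (1 + 4 * \<epsilon>\<^sup>2) / (2 + S))) = 1 + 4 * \<epsilon>\<^sup>2"
      using S0 by (simp add: add_pos_nonneg)
    finally have "(dwalk (q n) n (mu n) (t n))\<^sup>2 \<le> \<epsilon>\<^sup>2 + Ls n / 4" by simp
    hence "dwalk (q n) n (mu n) (t n) \<le> sqrt (\<epsilon>\<^sup>2 + Ls n / 4)" by (rule real_le_rsqrt)
    thus ?case by (simp add: e_def)
  qed
  thus ?thesis using e0 by blast
qed

subsection \<open>The lower bound\<close>

text \<open>The left side factors as \<open>(1 - cos a) (1 - cos b) - s sin a sin b\<close>. Its
  main part \<open>- s a b\<close> becomes a covariance after averaging; the first product costs
  \<open>1/8\<close> and replacing the sines costs \<open>1/6\<close>, together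
  \<open>7/24 \<le> 1/2\<close>.\<close>

lemma cos_pair_le:
  fixes a b \<rho> s :: real
  assumes a: "\<bar>a\<bar> \<le> \<rho>" and b: "\<bar>b\<bar> \<le> \<rho>" and s: "s = 1 \<or> s = - 1"
  shows "cos (a + s * b) - cos a - cos b + 1 \<le> - s * (a * b) + \<rho>\<^sup>2 / 2 * (a\<^sup>2 + b\<^sup>2)"
proof -
  have a2: "a\<^sup>2 \<le> \<rho>\<^sup>2" and b2: "b\<^sup>2 \<le> \<rho>\<^sup>2"
    using power_mono[OF a, of 2] power_mono[OF b, of 2] by simp_all
  have id: "cos (a + s * b) - cos a - cos b + 1 = (1 - cos a) * (1 - cos b) + - s * (sin a * sin b)"
    using s by (auto simp: cos_add cos_diff algebra_simps)
  have c: "(1 - cos a) * (1 - cos b) \<le> \<rho>\<^sup>2 / 8 * (a\<^sup>2 + b\<^sup>2)"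
  proof -
    have "(1 - cos a) * (1 - cos b) \<le> (a\<^sup>2 / 2) * (b\<^sup>2 / 2)"
      using cos_ge_quadratic[of a] cos_ge_quadratic[of b] by (intro mult_mono) auto
    also have "\<dots> = (a\<^sup>2 * b\<^sup>2 + b\<^sup>2 * a\<^sup>2) / 8" by simp
    also have "\<dots> \<le> (a\<^sup>2 * \<rho>\<^sup>2 + b\<^sup>2 * \<rho>\<^sup>2) / 8"
      using a2 b2 by (intro divide_right_mono add_mono mult_left_mono) auto
    finally show ?thesis by (simp add: algebra_simps)
  qed
  have ab: "2 * (\<bar>a\<bar> * \<bar>b\<bar>) \<le> a\<^sup>2 + b\<^sup>2"
    using zero_le_power2[of "\<bar>a\<bar> - \<bar>b\<bar>"] by (simp add: power2_diff)
  have "\<bar>sin a * sin b - a * b\<bar> = \<bar>(sin a - a) * sin b + a * (sin b - b)\<bar>"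
    by (simp add: algebra_simps)
  also have "\<dots> \<le> \<bar>sin a - a\<bar> * \<bar>sin b\<bar> + \<bar>a\<bar> * \<bar>sin b - b\<bar>"
    unfolding abs_mult[symmetric] by (rule abs_triangle_ineq)
  also have "\<dots> \<le> (\<bar>a\<bar> ^ 3 / 6) * \<bar>b\<bar> + \<bar>a\<bar> * (\<bar>b\<bar> ^ 3 / 6)"
    by (intro add_mono mult_mono abs_sin_minus_self_le abs_sin_x_le_abs_x) auto
  also have "\<dots> = (a\<^sup>2 * (\<bar>a\<bar> * \<bar>b\<bar>) + b\<^sup>2 * (\<bar>a\<bar> * \<bar>b\<bar>)) / 6"
    by (simp add: power3_eq_cube power2_eq_square add_divide_distrib mult_ac)
  also have "\<dots> \<le> (\<rho>\<^sup>2 * (\<bar>a\<bar> * \<bar>b\<bar>) + \<rho>\<^sup>2 * (\<bar>a\<bar> * \<bar>b\<bar>)) / 6"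
    using a2 b2 by (intro divide_right_mono add_mono mult_right_mono) auto
  also have "\<dots> = \<rho>\<^sup>2 / 6 * (2 * (\<bar>a\<bar> * \<bar>b\<bar>))" by simp
  also have "\<dots> \<le> \<rho>\<^sup>2 / 6 * (a\<^sup>2 + b\<^sup>2)" by (intro mult_left_mono ab) simp
  finally have "\<bar>sin a * sin b - a * b\<bar> \<le> \<rho>\<^sup>2 / 6 * (a\<^sup>2 + b\<^sup>2)" .
  moreover have "- s * p \<le> - s * w + X" if "\<bar>p - w\<bar> \<le> X" for p w X
    using s that by (elim disjE) (auto simp: abs_le_iff)
  ultimately have sn: "- s * (sin a * sin b) \<le> - s * (a * b) + \<rho>\<^sup>2 / 6 * (a\<^sup>2 + b\<^sup>2)"
    by blast
  have "cos (a + s * b) - cos a - cos b + 1 \<le> \<rho>\<^sup>2 / 8 * (a\<^sup>2 + b\<^sup>2) + (- s * (a * b) + \<rho>\<^sup>2 / 6 * (a\<^sup>2 + b\<^sup>2))"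
    unfolding id by (rule add_mono[OF c sn])
  also have "\<dots> = - s * (a * b) + 7 / 24 * (\<rho>\<^sup>2 * (a\<^sup>2 + b\<^sup>2))" by simp
  also have "\<dots> \<le> - s * (a * b) + 1 / 2 * (\<rho>\<^sup>2 * (a\<^sup>2 + b\<^sup>2))"
    by (intro add_left_mono mult_right_mono) auto
  finally show ?thesis by simp
qed

definition unit_vec :: "nat \<Rightarrow> nat \<Rightarrow> int" where
  "unit_vec k = (\<lambda>j. if j = k then 1 else 0)"

context torus_walk_moments
begin

lemma chi_unit:
  assumes "k < n"
  shows "Re (chi q n (unit_vec k) y) = cos (2 * pi / real q * real_of_int (y k))"
proof -
  have "(\<Sum>i<n. unit_vec k i * y i) = (\<Sum>i<n. if i = k then y i else 0)"
    by (intro sum.cong) (auto simp: unit_vec_def)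
  also have "\<dots> = y k" using assms by simp
  finally show ?thesis by (simp add: chi_def)
qed

lemma chi_unit_pair:
  assumes "k < n" "l < n"
  shows "Re (chi q n (\<lambda>i. unit_vec k i + s * unit_vec l i) y) =
           cos (2 * pi / real q * real_of_int (y k) + real_of_int s * (2 * pi / real q * real_of_int (y l)))"
proof -
  have "(\<Sum>i<n. (unit_vec k i + s * unit_vec l i) * y i) = (\<Sum>i<n. if i = k then y i else 0) + (\<Sum>i<n. if i = l then s * y i else 0)"
    unfolding sum.distrib[symmetric] by (intro sum.cong) (auto simp: unit_vec_def algebra_simps)
  also have "\<dots> = y k + s * y l" using assms by simp
  finally show ?thesis by (simp add: chi_def add_divide_distrib distrib_left mult_ac)
qed

text \<open>Product-to-sum turns second moments of the test function into expectations of single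
  characters, which the spectral formula evaluates.\<close>

lemma Re_chi_product:
  assumes "k < n" "l < n"
  shows "Re (chi q n (unit_vec k) y) * Re (chi q n (unit_vec l) y) =
     (Re (chi q n (\<lambda>i. unit_vec k i + 1 * unit_vec l i) y) + Re (chi q n (\<lambda>i. unit_vec k i + (- 1) * unit_vec l i) y)) / 2"
  unfolding chi_unit_pair[OF assms] chi_unit[OF assms(1)] chi_unit[OF assms(2)]
  by (simp add: cos_add cos_diff)

lemma sum_Re_chi_0:
  assumes "i < n" "\<not> int q dvd w i"
  shows "(\<Sum>z\<in>A. Re (chi q n w z)) = 0"
  using arg_cong[OF sum_chi[OF q_pos, of n w], of Re] assms by auto

lemma Lam_chi: "Lam w = E (\<lambda>y. Re (chi q n w y))"
  by (simp add: Lam_eq Ex_mu_def)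

text \<open>By \<open>sum_Hker_cos\<close> and \<open>chi_unit\<close>, the mean of the cosine of
  the \<open>k\<close>-th coordinate at time \<open>t\<close> for the walk started at 0.\<close>

definition decay_rate :: "real \<Rightarrow> nat \<Rightarrow> real" where
  "decay_rate t k = exp (t * (Lam (unit_vec k) - 1))"

text \<open>\<open>L\<close> is the time in units of \<open>n q ^ 2 / (4 pi ^ 2 s2)\<close>. In
  these units the quadratic lower bound on the cosine costs at most \<open>L / 2\<close> in the
  exponent, for every coordinate alike.\<close>

lemma decay_rate_ge:
  assumes k: "k < n" and t: "0 \<le> t" "t * (4 * pi\<^sup>2 * s2) \<le> real n * (real q)\<^sup>2 * L"
  shows "exp (- L / 2) \<le> decay_rate t k"
proof -
  define c where "c = 2 * pi / real q"
  have nq: "real n * (real q)\<^sup>2 > 0" using n_pos q_pos by simp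
  have "E (\<lambda>y. 1 - c\<^sup>2 / 2 * (real_of_int (y k))\<^sup>2) \<le> E (\<lambda>y. Re (chi q n (unit_vec k) y))"
  proof (rule E_mono)
    fix y show "1 - c\<^sup>2 / 2 * (real_of_int (y k))\<^sup>2 \<le> Re (chi q n (unit_vec k) y)"
      unfolding chi_unit[OF k] c_def[symmetric]
      using cos_ge_quadratic[of "c * real_of_int (y k)"] by (simp add: power_mult_distrib)
  qed
  hence "1 - c\<^sup>2 / 2 * (s2 / real n) \<le> Lam (unit_vec k)"
    unfolding E_diff E_const E_cmult E_square[OF k] Lam_chi[symmetric] .
  from mult_left_mono[OF this t(1)]
  have "- (t * (c\<^sup>2 / 2 * (s2 / real n))) \<le> t * (Lam (unit_vec k) - 1)"
    by (simp add: algebra_simps)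
  moreover have "t * (c\<^sup>2 / 2 * (s2 / real n)) = t * (4 * pi\<^sup>2 * s2) / (real n * (real q)\<^sup>2) / 2"
    by (simp add: c_def power_divide power_mult_distrib mult_ac)
  moreover have "t * (4 * pi\<^sup>2 * s2) / (real n * (real q)\<^sup>2) / 2 \<le> L / 2"
    using t(2) nq by (intro divide_right_mono) (simp_all add: pos_divide_le_eq mult.commute)
  ultimately have "- (L / 2) \<le> t * (Lam (unit_vec k) - 1)"
    using order.trans[OF le_imp_neg_le] by simp
  thus ?thesis by (simp add: decay_rate_def)
qed

text \<open>For independent coordinate processes the exponents would simply add. The defect is the
  mean of the expression in \<open>cos_pair_le\<close>, hence governed by the correlation and by
  \<open>\<rho> ^ 2\<close> with \<open>\<rho> = 2 pi r / q\<close>, since each coordinate is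
  bounded by the l1 norm. Multiplication by \<open>t\<close> turns the common variance factor into
  at most \<open>L\<close>.\<close>

lemma pair_decay_le:
  assumes kl: "k < n" "l < n" and s: "s = 1 \<or> s = - 1"
    and t: "0 \<le> t" "t * (4 * pi\<^sup>2 * s2) \<le> real n * (real q)\<^sup>2 * L"
    and \<kappa>: "\<bar>Corr k l\<bar> \<le> \<kappa>"
  shows "exp (t * (Lam (\<lambda>i. unit_vec k i + s * unit_vec l i) - 1))
           \<le> exp (L * (\<kappa> + 4 * pi\<^sup>2 * r\<^sup>2 / (real q)\<^sup>2)) * (decay_rate t k * decay_rate t l)"
proof -
  define c where "c = 2 * pi / real q"
  define \<rho> where "\<rho> = c * r"
  have c0: "c > 0" using q_pos by (simp add: c_def)
  have nq: "real n * (real q)\<^sup>2 > 0" using n_pos q_pos by simp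
  have s': "real_of_int s = 1 \<or> real_of_int s = - 1" using s by auto
  have bd: "\<bar>c * real_of_int (y k)\<bar> \<le> \<rho>" if "y \<in> A" "mu y > 0" "k < n" for y k
  proof -
    have "real_of_int \<bar>y k\<bar> \<le> (\<Sum>i<n. real_of_int \<bar>y i\<bar>)"
      using that by (intro member_le_sum) auto
    also have "\<dots> \<le> r" by (rule l1[OF that(1,2)])
    finally show ?thesis unfolding \<rho>_def using c0 by (simp add: abs_mult)
  qed
  have "Lam (\<lambda>i. unit_vec k i + s * unit_vec l i) - Lam (unit_vec k) - Lam (unit_vec l) + 1
     = E (\<lambda>y. Re (chi q n (\<lambda>i. unit_vec k i + s * unit_vec l i) y) - Re (chi q n (unit_vec k) y)
           - Re (chi q n (unit_vec l) y) + 1)"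
    unfolding Lam_chi E_add E_diff E_const ..
  also have "\<dots> \<le> E (\<lambda>y. - real_of_int s * c\<^sup>2 * (real_of_int (y k) * real_of_int (y l))
       + \<rho>\<^sup>2 / 2 * c\<^sup>2 * ((real_of_int (y k))\<^sup>2 + (real_of_int (y l))\<^sup>2))"
  proof (rule E_mono)
    fix y assume y: "y \<in> A" "mu y > 0"
    show "Re (chi q n (\<lambda>i. unit_vec k i + s * unit_vec l i) y) - Re (chi q n (unit_vec k) y)
           - Re (chi q n (unit_vec l) y) + 1 \<le> - real_of_int s * c\<^sup>2 * (real_of_int (y k) * real_of_int (y l))
       + \<rho>\<^sup>2 / 2 * c\<^sup>2 * ((real_of_int (y k))\<^sup>2 + (real_of_int (y l))\<^sup>2)"
      unfolding chi_unit_pair[OF kl] chi_unit[OF kl(1)] chi_unit[OF kl(2)] c_def[symmetric]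
      using cos_pair_le[OF bd[OF y kl(1)] bd[OF y kl(2)] s']
      by (simp add: power_mult_distrib power2_eq_square algebra_simps)
  qed
  also have "\<dots> = - real_of_int s * c\<^sup>2 * (s2 / real n * Corr k l) + \<rho>\<^sup>2 / 2 * c\<^sup>2 * (s2 / real n + s2 / real n)"
    by (simp only: E_add E_cmult E_product[OF kl] E_square kl)
  also have "\<dots> = c\<^sup>2 * (s2 / real n) * (- real_of_int s * Corr k l + \<rho>\<^sup>2)"
    by (simp add: algebra_simps)
  also have "\<dots> \<le> c\<^sup>2 * (s2 / real n) * (\<kappa> + \<rho>\<^sup>2)"
    using \<kappa> s' s2_pos by (intro mult_left_mono add_right_mono) (auto simp: abs_le_iff)
  finally have 1: "t * (Lam (\<lambda>i. unit_vec k i + s * unit_vec l i) - Lam (unit_vec k) - Lam (unit_vec l) + 1)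
      \<le> t * (c\<^sup>2 * (s2 / real n) * (\<kappa> + \<rho>\<^sup>2))" by (intro mult_left_mono t(1))
  have "t * (c\<^sup>2 * (s2 / real n)) = t * (4 * pi\<^sup>2 * s2) / (real n * (real q)\<^sup>2)"
    by (simp add: c_def power_divide power_mult_distrib)
  also have "\<dots> \<le> L" using t(2) nq by (simp add: pos_divide_le_eq mult.commute)
  finally have "t * (c\<^sup>2 * (s2 / real n)) * (\<kappa> + \<rho>\<^sup>2) \<le> L * (\<kappa> + \<rho>\<^sup>2)"
    using \<kappa> by (intro mult_right_mono add_nonneg_nonneg) auto
  with 1 have "t * (Lam (\<lambda>i. unit_vec k i + s * unit_vec l i) - 1) \<le>
      L * (\<kappa> + \<rho>\<^sup>2) + (t * (Lam (unit_vec k) - 1) + t * (Lam (unit_vec l) - 1))"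
    by (simp add: algebra_simps)
  moreover have "\<rho>\<^sup>2 = 4 * pi\<^sup>2 * r\<^sup>2 / (real q)\<^sup>2"
    by (simp add: \<rho>_def c_def power_divide power_mult_distrib)
  ultimately show ?thesis
    unfolding decay_rate_def exp_add[symmetric] by simp
qed

lemma dwalk_lower:
  assumes q3: "q \<ge> 3" and t: "0 \<le> t" "t * (4 * pi\<^sup>2 * s2) \<le> real n * (real q)\<^sup>2 * L"
    and \<kappa>: "\<And>k l. k < n \<Longrightarrow> l < n \<Longrightarrow> k \<noteq> l \<Longrightarrow> \<bar>Corr k l\<bar> \<le> \<kappa>"
  defines "\<delta> \<equiv> exp (L * (\<kappa> + 4 * pi\<^sup>2 * r\<^sup>2 / (real q)\<^sup>2)) - 1"
  assumes \<delta>: "0 \<le> \<delta>"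
  shows "1 \<le> (4 * exp L / real n + 2 * \<delta> + 1) * dwalk q n mu t"
proof -
  define X where "X k y = Re (chi q n (unit_vec k) y)" for k y
  define f where "f y = (\<Sum>k<n. X k y)" for y
  define H0 where "H0 = H t (\<lambda>_. 0)"
  define m where "m = (\<Sum>z\<in>A. H0 z * f z)"
  define e where "e = decay_rate t"
  have z0: "(\<lambda>_. 0) \<in> A" by (rule zero_in_reps[OF q_pos])
  have Hsum: "(\<Sum>z\<in>A. H0 z) = 1" unfolding H0_def by (rule sum_Hker[OF z0])
  have Hnn: "0 \<le> H0 z" if "z \<in> A" for z unfolding H0_def by (rule Hker_nonneg[OF z0 that t(1)])
  have nd: "\<not> int q dvd a" if "a \<noteq> 0" "\<bar>a\<bar> \<le> 2" for a :: int
  proof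
    assume "int q dvd a"
    hence "\<bar>int q\<bar> \<le> \<bar>a\<bar>" using that(1) by (intro dvd_imp_le_int)
    thus False using q3 that(2) by simp
  qed
  have f0: "(\<Sum>z\<in>A. f z) = 0"
  proof -
    have "(\<Sum>z\<in>A. f z) = (\<Sum>k<n. \<Sum>z\<in>A. X k z)" unfolding f_def by (rule sum.swap)
    also have "\<dots> = (\<Sum>k<n. 0)"
      unfolding X_def
    proof (intro sum.cong refl)
      fix k assume "k \<in> {..<n}"
      thus "(\<Sum>z\<in>A. Re (chi q n (unit_vec k) z)) = 0"
        by (intro sum_Re_chi_0[of k] nd) (auto simp: unit_vec_def)
    qed
    finally show ?thesis by simp
  qed
  have m: "m = (\<Sum>k<n. e k)"
  proof -
    have "m = (\<Sum>k<n. \<Sum>z\<in>A. H0 z * X k z)"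
      unfolding m_def f_def sum_distrib_left by (rule sum.swap)
    thus ?thesis unfolding H0_def X_def sum_Hker_cos e_def decay_rate_def .
  qed
  have e_pos: "0 < e k" for k by (simp add: e_def decay_rate_def)
  have X2: "(X k z)\<^sup>2 \<le> 1" for k z
    unfolding X_def chi_def by (simp add: abs_square_le_1)
  have f2: "(f z)\<^sup>2 = (\<Sum>k<n. \<Sum>l<n. X k z * X l z)" for z
    by (simp add: f_def power2_eq_square sum_product)
  have swap: "(\<Sum>z\<in>A. w z * (f z)\<^sup>2) = (\<Sum>k<n. \<Sum>l<n. \<Sum>z\<in>A. w z * (X k z * X l z))" for w :: "(nat \<Rightarrow> int) \<Rightarrow> real"
    unfolding f2 sum_distrib_left
    by (subst sum.swap, intro sum.cong refl, rule sum.swap)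
  have diag: "(\<Sum>k<n. \<Sum>l<n. if k = l then c else 0) = real n * c" for c :: real
    by simp
  have V0: "(\<Sum>z\<in>A. (f z)\<^sup>2) / N \<le> real n"
  proof -
    have "(\<Sum>z\<in>A. (f z)\<^sup>2) = (\<Sum>k<n. \<Sum>l<n. \<Sum>z\<in>A. 1 * (X k z * X l z))"
      using swap[of "\<lambda>_. 1"] by simp
    also have "\<dots> \<le> (\<Sum>k<n. \<Sum>l<n. if k = l then N else 0)"
    proof (intro sum_mono)
      fix k l assume kl: "k \<in> {..<n}" "l \<in> {..<n}"
      show "(\<Sum>z\<in>A. 1 * (X k z * X l z)) \<le> (if k = l then N else 0)"
      proof (cases "k = l")
        case True
        have "(\<Sum>z\<in>A. 1 * (X k z * X l z)) \<le> (\<Sum>z\<in>A. 1)"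
          using X2[of k] by (intro sum_mono) (auto simp: True power2_eq_square)
        thus ?thesis using True by simp
      next
        case False
        have kl': "k < n" "l < n" using kl by auto
        \<comment> \<open>For \<open>k \<noteq> l\<close> coordinate \<open>k\<close> of the
          combined frequency is 1 whatever \<open>s\<close> is, so the frequency is nonzero modulo
          \<open>q\<close>. The cosines are therefore orthogonal under the uniform measure.\<close>
        have zero: "(\<Sum>z\<in>A. Re (chi q n (\<lambda>i. unit_vec k i + s * unit_vec l i) z)) = 0" for s
          using kl False by (intro sum_Re_chi_0[of k] nd) (auto simp: unit_vec_def)
        have "(\<Sum>z\<in>A. X k z * X l z) = (0 + 0) / 2"
          unfolding X_def Re_chi_product[OF kl'] sum_divide_distrib[symmetric] sum.distrib zero ..
        thus ?thesis using False by simp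
      qed
    qed
    also have "\<dots> = real n * N" by (rule diag)
    finally show ?thesis using N_pos by (simp add: field_simps)
  qed
  have V1: "(\<Sum>z\<in>A. H0 z * (f z)\<^sup>2) \<le> real n + (1 + \<delta>) * m\<^sup>2"
  proof -
    \<comment> \<open>The diagonal is bounded crudely by 1; allowing the positive term
      \<open>(1 + \<delta>) * (e k * e l)\<close> there as well completes the double sum to
      \<open>(1 + \<delta>) * m ^ 2\<close>.\<close>
    have "(\<Sum>z\<in>A. H0 z * (f z)\<^sup>2) \<le> (\<Sum>k<n. \<Sum>l<n. (if k = l then 1 else 0) + (1 + \<delta>) * (e k * e l))"
      unfolding swap
    proof (intro sum_mono)
      fix k l assume "k \<in> {..<n}" "l \<in> {..<n}"
      hence kl: "k < n" "l < n" by auto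
      show "(\<Sum>z\<in>A. H0 z * (X k z * X l z)) \<le> (if k = l then 1 else 0) + (1 + \<delta>) * (e k * e l)"
      proof (cases "k = l")
        case True
        have "(\<Sum>z\<in>A. H0 z * (X k z * X l z)) \<le> (\<Sum>z\<in>A. H0 z * 1)"
          using X2[of k] Hnn by (intro sum_mono mult_left_mono) (auto simp: True power2_eq_square)
        moreover have "0 \<le> (1 + \<delta>) * (e k * e l)"
          using \<delta> e_pos[of k] e_pos[of l] by simp
        ultimately show ?thesis using True Hsum by simp
      next
        case False
        define Y where "Y s = exp (t * (Lam (\<lambda>i. unit_vec k i + s * unit_vec l i) - 1))" for s :: int
        have "(\<Sum>z\<in>A. H0 z * (X k z * X l z)) = (Y 1 + Y (- 1)) / 2"
          unfolding Y_def sum_Hker_cos[symmetric] H0_def X_def Re_chi_product[OF kl]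
            sum.distrib[symmetric] sum_divide_distrib
          by (intro sum.cong refl) (simp add: distrib_left add_divide_distrib)
        moreover have "Y s \<le> (1 + \<delta>) * (e k * e l)" if "s = 1 \<or> s = - 1" for s
          using pair_decay_le[OF kl that t \<kappa>[OF kl False]] by (simp add: Y_def \<delta>_def e_def)
        from this[of 1] this[of "- 1"] have "(Y 1 + Y (- 1)) / 2 \<le> (1 + \<delta>) * (e k * e l)" by simp
        ultimately show ?thesis using False by simp
      qed
    qed
    also have "\<dots> = real n * 1 + (\<Sum>k<n. \<Sum>l<n. (1 + \<delta>) * (e k * e l))"
      unfolding sum.distrib diag ..
    also have "(\<Sum>k<n. \<Sum>l<n. (1 + \<delta>) * (e k * e l)) = (1 + \<delta>) * (m * m)"
      unfolding m by (simp only: sum_distrib_left[symmetric] sum_distrib_right[symmetric])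
    also have "real n * 1 + (1 + \<delta>) * (m * m) = real n + (1 + \<delta>) * m\<^sup>2"
      by (simp add: power2_eq_square)
    finally show ?thesis .
  qed
  have tv0: "0 \<le> tv_unif A H0" by (rule tv_unif_bound(1)[OF Hsum])
  have m_ge: "real n * exp (- L / 2) \<le> m"
    unfolding m using sum_mono[of "{..<n}" "\<lambda>_. exp (- L / 2)" e] decay_rate_ge[OF _ t]
    by (simp add: e_def)
  have "0 < real n * exp (- L / 2)" using n_pos by simp
  hence m0: "m > 0" using m_ge by linarith
  \<comment> \<open>The two variance bounds contain \<open>n\<close> once each, doubled in
    \<open>tv_unif_lower\<close> to \<open>4 n\<close>. Trading \<open>n\<close> for a multiple of
    \<open>m ^ 2\<close>, by \<open>m \<ge> n * exp (- L / 2)\<close>, lets \<open>m ^ 2\<close>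
    cancel from the whole inequality.\<close>
  have nm: "real n \<le> exp L / real n * m\<^sup>2"
  proof -
    have "exp L * exp (- L) = 1" by (simp only: exp_add[symmetric]) simp
    hence "real n = exp L / real n * ((real n)\<^sup>2 * exp (- L))"
      using n_pos by (simp add: power2_eq_square mult_ac)
    also have "(real n)\<^sup>2 * exp (- L) = (real n * exp (- L / 2))\<^sup>2"
      using exp_double[of "- L / 2"] by (simp add: power_mult_distrib)
    also have "exp L / real n * (real n * exp (- L / 2))\<^sup>2 \<le> exp L / real n * m\<^sup>2"
      using m_ge by (intro mult_left_mono power_mono) auto
    finally show ?thesis .
  qed
  have "m\<^sup>2 \<le> (2 * ((\<Sum>z\<in>A. H0 z * (f z)\<^sup>2) - m\<^sup>2 + (\<Sum>z\<in>A. (f z)\<^sup>2) / N) + m\<^sup>2) * tv_unif A H0"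
    unfolding m_def by (rule tv_unif_lower[OF Hsum Hnn f0])
  also have "\<dots> \<le> (2 * ((real n + (1 + \<delta>) * m\<^sup>2) - m\<^sup>2 + real n) + m\<^sup>2) * tv_unif A H0"
    by (intro mult_right_mono tv0 add_right_mono mult_left_mono add_mono diff_right_mono V0 V1) simp
  also have "\<dots> = (4 * real n + (2 * \<delta> + 1) * m\<^sup>2) * tv_unif A H0" by (simp add: algebra_simps)
  also have "\<dots> \<le> (4 * (exp L / real n * m\<^sup>2) + (2 * \<delta> + 1) * m\<^sup>2) * tv_unif A H0"
    by (intro mult_right_mono tv0 add_right_mono mult_left_mono nm) simp
  also have "\<dots> = m\<^sup>2 * ((4 * exp L / real n + 2 * \<delta> + 1) * tv_unif A H0)" by (simp add: algebra_simps)
  finally have "m\<^sup>2 * 1 \<le> m\<^sup>2 * ((4 * exp L / real n + 2 * \<delta> + 1) * tv_unif A H0)" by simp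
  hence "1 \<le> (4 * exp L / real n + 2 * \<delta> + 1) * tv_unif A H0"
    using m0 by (subst (asm) mult_le_cancel_left_pos) auto
  also have "\<dots> \<le> (4 * exp L / real n + 2 * \<delta> + 1) * dwalk q n mu t"
    using \<delta> tv_unif_le_dwalk[of t] by (intro mult_left_mono) (auto simp: H0_def intro!: add_nonneg_nonneg)
  finally show ?thesis .
qed

end

lemma mixing_lower:
  fixes q :: "nat \<Rightarrow> nat" and r sig2 :: "nat \<Rightarrow> real" and mu :: "nat \<Rightarrow> (nat \<Rightarrow> int) \<Rightarrow> real"
  assumes walk: "\<And>n. n \<ge> 1 \<Longrightarrow> torus_walk_moments (q n) n (mu n) (r n) (sig2 n)"
    and eps: "0 < \<epsilon>" "\<epsilon> < 1"
    and q: "filterlim q at_top sequentially"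
    and corr: "(\<lambda>n. ln (real n) * Max ({\<bar>Corr_mu (q n) n (mu n) k l\<bar> | k l. k < n \<and> l < n \<and> k \<noteq> l} \<union> {0})) \<longlonglongrightarrow> 0"
    and rq: "(\<lambda>n. ln (real n) * (r n)\<^sup>2 / (real (q n))\<^sup>2) \<longlonglongrightarrow> 0"
  shows "\<forall>\<^sub>F n in sequentially. real n * (real (q n))\<^sup>2 / (4 * pi\<^sup>2 * sig2 n) * (ln (real n) + ln ((1 / \<epsilon> - 1) / 5))
           \<le> tmix (q n) n (mu n) \<epsilon>"
proof -
  \<comment> \<open>Chosen so that \<open>1 / \<epsilon> = 5 c + 1\<close>. Since
    \<open>exp L = n c\<close> below, \<open>dwalk_lower\<close> gives the factor
    \<open>4 c + 2 d + 1\<close>; the fifth \<open>c\<close> is room for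
    \<open>2 d < c\<close>.\<close>
  define c where "c = (1 / \<epsilon> - 1) / 5"
  have c: "c > 0" using eps by (simp add: c_def)
  define \<kappa> where "\<kappa> n = Max ({\<bar>Corr_mu (q n) n (mu n) k l\<bar> | k l. k < n \<and> l < n \<and> k \<noteq> l} \<union> {0})" for n
  have fin: "finite ({\<bar>Corr_mu (q n) n (mu n) k l\<bar> | k l. k < n \<and> l < n \<and> k \<noteq> l} \<union> {0})" for n
  proof -
    have sub: "{\<bar>Corr_mu (q n) n (mu n) k l\<bar> | k l. k < n \<and> l < n \<and> k \<noteq> l}
       \<subseteq> (\<lambda>(k, l). \<bar>Corr_mu (q n) n (mu n) k l\<bar>) ` ({..<n} \<times> {..<n})" by auto
    show ?thesis using finite_subset[OF sub] by simp
  qed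
  have \<kappa>0: "0 \<le> \<kappa> n" for n unfolding \<kappa>_def by (rule Max_ge[OF fin]) simp
  have \<kappa>: "\<bar>Corr_mu (q n) n (mu n) k l\<bar> \<le> \<kappa> n" if "k < n" "l < n" "k \<noteq> l" for n k l
    unfolding \<kappa>_def by (rule Max_ge[OF fin]) (use that in blast)
  \<comment> \<open>An upper bound for \<open>L * (\<kappa> n + D)\<close>: eventually
    \<open>c \<le> n\<close>, so \<open>L \<le> 2 * ln n\<close>, and this doubles the constants 1
    and \<open>4 pi ^ 2\<close>.\<close>
  define x where "x n = 2 * (ln (real n) * \<kappa> n) + 8 * pi\<^sup>2 * (ln (real n) * (r n)\<^sup>2 / (real (q n))\<^sup>2)" for n
  have "(\<lambda>n. exp (x n) - 1) \<longlonglongrightarrow> exp (2 * 0 + 8 * pi\<^sup>2 * 0) - 1"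
    unfolding x_def \<kappa>_def by (intro tendsto_intros corr rq)
  hence ev1: "\<forall>\<^sub>F n in sequentially. exp (x n) - 1 < c / 2"
    using c by (intro order_tendstoD(2)) auto
  have ev2: "\<forall>\<^sub>F n in sequentially. max 1 c \<le> real n"
    using filterlim_at_top[THEN iffD1, OF filterlim_real_sequentially] by blast
  have ev3: "\<forall>\<^sub>F n in sequentially. 3 \<le> q n"
    using filterlim_at_top[THEN iffD1, OF q] by blast
  show ?thesis
    using ev1 ev2 ev3
  proof eventually_elim
    case (elim n)
    hence n: "n \<ge> 1" by simp
    interpret torus_walk_moments "q n" n "mu n" "r n" "sig2 n" by (rule walk[OF n])
    define L where "L = ln (real n) + ln c"
    have LL: "L \<le> 2 * ln (real n)"
      unfolding L_def using elim(2) c n ln_mono[of c "real n"] by simp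
    have expL: "exp L = real n * c" unfolding L_def using c n by (simp add: exp_add)
    define K where "K = real n * (real (q n))\<^sup>2 / (4 * pi\<^sup>2 * sig2 n)"
    have K: "K > 0" unfolding K_def using n q_pos s2_pos by simp
    show ?case unfolding c_def[symmetric] L_def[symmetric] K_def[symmetric]
    proof (rule tmix_geI[OF _ eps(1)])
      fix t assume t: "0 \<le> t" "t < K * L"
      \<comment> \<open>If \<open>L \<le> 0\<close> the interval of times below \<open>K * L\<close>
        is empty, so any admissible \<open>t\<close> forces \<open>L\<close> to be positive.\<close>
      have L: "0 < L" using t K by (smt (verit) mult_nonneg_nonpos)
      define D where "D = 4 * pi\<^sup>2 * (r n)\<^sup>2 / (real (q n))\<^sup>2"
      have D: "0 \<le> D" by (simp add: D_def)
      have t': "t * (4 * pi\<^sup>2 * sig2 n) \<le> real n * (real (q n))\<^sup>2 * L"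
        using t(2) s2_pos by (simp add: K_def field_simps)
      have "0 \<le> L * (\<kappa> n + D)" using L \<kappa>0[of n] D by simp
      hence \<delta>0: "0 \<le> exp (L * (\<kappa> n + D)) - 1" by simp
      have "L * (\<kappa> n + D) \<le> 2 * ln (real n) * (\<kappa> n + D)"
        using \<kappa>0[of n] D by (intro mult_right_mono LL) auto
      also have "\<dots> = x n" by (simp add: x_def D_def algebra_simps)
      finally have "exp (L * (\<kappa> n + D)) - 1 \<le> exp (x n) - 1" by simp
      hence \<delta>: "exp (L * (\<kappa> n + D)) - 1 < c / 2" using elim(1) by linarith
      define d where "d = exp (L * (\<kappa> n + D)) - 1"
      define F where "F = 4 * exp L / real n + 2 * d + 1"
      have low: "1 \<le> F * dwalk (q n) n (mu n) t"
        unfolding F_def d_def D_def by (rule dwalk_lower[OF elim(3) t(1) t' \<kappa> \<delta>0[unfolded D_def]])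
      have "4 * exp L / real n = 4 * c" using n by (simp add: expL)
      hence "F = 4 * c + 2 * d + 1" by (simp only: F_def)
      moreover have "d < c / 2" using \<delta> by (simp only: d_def)
      ultimately have "F < 5 * c + 1" by linarith
      also have "\<dots> = 1 / \<epsilon>" using eps by (simp add: c_def field_simps)
      finally have F: "F < 1 / \<epsilon>" .
      have d_pos: "dwalk (q n) n (mu n) t > 0"
        using low dwalk_bound(1)[of t] by (cases "dwalk (q n) n (mu n) t = 0") auto
      have "1 < 1 / \<epsilon> * dwalk (q n) n (mu n) t"
        using low mult_strict_right_mono[OF F d_pos] by linarith
      thus "\<epsilon> < dwalk (q n) n (mu n) t" using eps by (simp add: field_simps)
    qed
  qed
qed

theorem theorem3:
  fixes q :: "nat \<Rightarrow> nat" and r :: "nat \<Rightarrow> real" and sig2 :: "nat \<Rightarrow> real"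
    and mu :: "nat \<Rightarrow> (nat \<Rightarrow> int) \<Rightarrow> real" and \<epsilon> :: real
  assumes walk: "\<And>n. n \<ge> 1 \<Longrightarrow> sym_walk_measure (q n) n (mu n)"
    and r_pos: "\<And>n. r n > 0" and sig2_pos: "\<And>n. sig2 n > 0"
    and l1: "\<And>n y. n \<ge> 1 \<Longrightarrow> y \<in> reps (q n) n \<Longrightarrow> mu n y > 0 \<Longrightarrow>
               (\<Sum>i<n. real_of_int \<bar>y i\<bar>) \<le> r n"
    and linf: "\<And>n y i. n \<ge> 1 \<Longrightarrow> y \<in> reps (q n) n \<Longrightarrow> mu n y > 0 \<Longrightarrow> i < n \<Longrightarrow>
               real_of_int \<bar>y i\<bar> < real (q n) / 2"
    and var: "\<And>n k. n \<ge> 1 \<Longrightarrow> k < n \<Longrightarrow> Var_mu (q n) n (mu n) k = sig2 n / real n"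
    and eps: "0 < \<epsilon>" "\<epsilon> < 1"
  shows
    "(\<forall>g. decay_condition q sig2 mu \<and>
          (\<forall>n\<ge>1. invertible_n n (Corr_mu (q n) n (mu n))) \<and>
          correlation_condition (\<lambda>n. minv n (Corr_mu (q n) n (mu n))) g \<and>
          filterlim q at_top sequentially \<and>
          ((\<lambda>n. (r n)^2 / real (q n)) \<longlongrightarrow> 0) sequentially \<longrightarrow>
       (let S = (SUP n\<in>{1..}. max_norm n (minv n (Corr_mu (q n) n (mu n))));
            \<alpha> = Inf {z. 1 \<le> z \<and> 4 * \<epsilon>^2 \<ge> exp ((2 + S) * g z) - 1};
            t = (\<lambda>n. real n * real (q n)^2 * ln (\<alpha> * real n) / (4 * pi^2 * sig2 n)
                      * inverse (1 - (r n)^2 / (12 * real (q n))))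
        in \<exists>e. (e \<longlongrightarrow> 0) sequentially \<and>
               (\<forall>\<^sub>F n in sequentially. dwalk (q n) n (mu n) (t n) \<le> \<epsilon> + e n)))
     \<and>
     (filterlim q at_top sequentially \<and>
      ((\<lambda>n. ln (real n) * Max ({\<bar>Corr_mu (q n) n (mu n) k l\<bar> | k l. k < n \<and> l < n \<and> k \<noteq> l} \<union> {0}))
          \<longlongrightarrow> 0) sequentially \<and>
      ((\<lambda>n. ln (real n) * (r n)^2 / (real (q n))^2) \<longlongrightarrow> 0) sequentially \<longrightarrow>
      (\<forall>\<^sub>F n in sequentially.
         tmix (q n) n (mu n) \<epsilon> \<ge>
           real n * real (q n)^2 / (4 * pi^2 * sig2 n) * (ln (real n) + ln ((1 / \<epsilon> - 1) / 5))))"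
proof (intro conjI allI impI)
  \<comment> \<open>For \<open>q = 0\<close> and \<open>n \<ge> 1\<close> there are no
    representatives, so total mass 1 would be impossible.\<close>
  have q_pos: "q n > 0" if "n \<ge> 1" for n
  proof (rule ccontr)
    assume "\<not> q n > 0"
    hence "reps (q n) n = {}" using that by (force simp: reps_def)
    thus False using walk[OF that] by (simp add: sym_walk_measure_def)
  qed
  have moments: "torus_walk_moments (q n) n (mu n) (r n) (sig2 n)" if "n \<ge> 1" for n
    by unfold_locales (use that q_pos walk sig2_pos r_pos l1 linf var in auto)
  {
    fix g
    assume "decay_condition q sig2 mu \<and>
          (\<forall>n\<ge>1. invertible_n n (Corr_mu (q n) n (mu n))) \<and>
          correlation_condition (\<lambda>n. minv n (Corr_mu (q n) n (mu n))) g \<and>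
          filterlim q at_top sequentially \<and>
          ((\<lambda>n. (r n)^2 / real (q n)) \<longlongrightarrow> 0) sequentially"
    thus "let S = (SUP n\<in>{1..}. max_norm n (minv n (Corr_mu (q n) n (mu n))));
            \<alpha> = Inf {z. 1 \<le> z \<and> 4 * \<epsilon>^2 \<ge> exp ((2 + S) * g z) - 1};
            t = (\<lambda>n. real n * real (q n)^2 * ln (\<alpha> * real n) / (4 * pi^2 * sig2 n)
                      * inverse (1 - (r n)^2 / (12 * real (q n))))
        in \<exists>e. (e \<longlongrightarrow> 0) sequentially \<and>
               (\<forall>\<^sub>F n in sequentially. dwalk (q n) n (mu n) (t n) \<le> \<epsilon> + e n)"
      unfolding Let_def using mixing_upper[OF moments eps(1)] by blast
  }
  assume "filterlim q at_top sequentially \<and>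
      ((\<lambda>n. ln (real n) * Max ({\<bar>Corr_mu (q n) n (mu n) k l\<bar> | k l. k < n \<and> l < n \<and> k \<noteq> l} \<union> {0}))
          \<longlongrightarrow> 0) sequentially \<and>
      ((\<lambda>n. ln (real n) * (r n)^2 / (real (q n))^2) \<longlongrightarrow> 0) sequentially"
  thus "\<forall>\<^sub>F n in sequentially.
         tmix (q n) n (mu n) \<epsilon> \<ge>
           real n * real (q n)^2 / (4 * pi^2 * sig2 n) * (ln (real n) + ln ((1 / \<epsilon> - 1) / 5))"
    using mixing_lower[OF moments eps] by blast
qed

end
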